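(* There exists a $C^2$ endomorphism $h:\mathbb{T}^2\to\mathbb{T}^2$ which is $C^2$-robustly transitive but not $C^1$-robustly transitive.
   Context: $\mathbb{T}^2=\mathbb{R}^2/\mathbb{Z}^2$. An endomorphism is a (not necessarily invertible, possibly with critical points) differentiable map $\mathbb{T}^2\to\mathbb{T}^2$. A continuous map $g:\mathbb{T}^2\to\mathbb{T}^2$ is transitive if for all nonempty open sets $U,V\subset\mathbb{T}^2$ there is $n\ge 1$ with $g^n(U)\cap V\neq\emptyset$ (equivalently, some forward orbit is dense). For $r\ge 1$, $C^r(\mathbb{T}^2)$ denotes the space of $C^r$ maps $\mathbb{T}^2\to\mathbb{T}^2$ with the $C^r$ topology. A map $f\in C^r(\mathbb{T}^2)$ is $C^r$-robustly transitive if there is a neighborhood $\mathcal{U}$ of $f$ in $C^r(\mathbb{T}^2)$ such that every $g\in\mathcal{U}$ is transitive. *)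

theory Defs
  imports "HOL-Analysis.Analysis"
begin

definition lattice_rel :: "real^2 \<Rightarrow> real^2 \<Rightarrow> bool" where
  "lattice_rel x y \<longleftrightarrow> (\<forall>i. x $ i - y $ i \<in> \<int>)"

lemma equivp_lattice_rel: "equivp lattice_rel"
proof (rule equivpI)
  show "reflp lattice_rel"
    by (simp add: reflp_def lattice_rel_def)
  show "symp lattice_rel"
    unfolding symp_def lattice_rel_def by (metis Ints_minus minus_diff_eq)
  show "transp lattice_rel"
    unfolding transp_def lattice_rel_def
    by (metis Ints_add diff_add_cancel add_diff_eq)
qed

quotient_type torus = "real^2" / lattice_rel
  morphisms rep_torus torus_proj
  by (rule equivp_lattice_rel)

lemma torus_proj_eq_iff: "torus_proj x = torus_proj y \<longleftrightarrow> (\<forall>i. x $ i - y $ i \<in> \<int>)"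
  by (simp add: torus.abs_eq_iff lattice_rel_def)

instantiation torus :: topological_space
begin

definition open_torus :: "torus set \<Rightarrow> bool" where
  "open_torus U \<longleftrightarrow> open (torus_proj -` U)"

instance
proof
  show "open (UNIV :: torus set)"
    by (simp add: open_torus_def)
  show "open (S \<inter> T)" if "open S" "open T" for S T :: "torus set"
    using that by (simp add: open_torus_def vimage_Int open_Int)
  show "open (\<Union>K)" if "\<forall>S\<in>K. open S" for K :: "torus set set"
    using that by (simp add: open_torus_def vimage_Union open_UN)
qed

end

text \<open>Meaningful for open \<open>S\<close>. In finite dimension, continuity of each directional derivative
  is the same as continuity of the derivative in operator norm.\<close>
primrec Ck_on :: "nat \<Rightarrow> 'a::euclidean_space set \<Rightarrow> ('a \<Rightarrow> 'b::euclidean_space) \<Rightarrow> bool" where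
  "Ck_on 0 S f \<longleftrightarrow> continuous_on S f"
| "Ck_on (Suc k) S f \<longleftrightarrow> (\<forall>x\<in>S. f differentiable (at x)) \<and>
     (\<forall>v. Ck_on k S (\<lambda>x. frechet_derivative f (at x) v))"

lemma Ck_on_Suc_imp: "Ck_on (Suc k) S f \<Longrightarrow> Ck_on k S f"
proof (induction k arbitrary: f)
  case 0
  then show ?case
    by (auto intro!: continuous_at_imp_continuous_on differentiable_imp_continuous_within)
next
  case (Suc k)
  then show ?case by (metis Ck_on.simps(2))
qed

text \<open>\<open>iter_deriv [v\<^sub>1, \<dots>, v\<^sub>k] F x\<close> is the value of the \<open>k\<close>-linear map \<open>D\<^sup>k F x\<close> at
  \<open>(v\<^sub>1, \<dots>, v\<^sub>k)\<close>.\<close>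
primrec iter_deriv :: "'a::euclidean_space list \<Rightarrow> ('a \<Rightarrow> 'b::euclidean_space) \<Rightarrow> 'a \<Rightarrow> 'b" where
  "iter_deriv [] F = F"
| "iter_deriv (v # vs) F = iter_deriv vs (\<lambda>x. frechet_derivative F (at x) v)"

text \<open>The local inverses of \<open>torus_proj\<close> are the charts of the torus, so \<open>F\<close> below is an expression
  of \<open>f\<close> in charts near \<open>torus_proj x\<close>. Two such \<open>F\<close> differ near \<open>x\<close> by a constant integer vector,
  hence have the same derivatives of every positive order at \<open>x\<close>.\<close>
definition local_lift :: "nat \<Rightarrow> (torus \<Rightarrow> torus) \<Rightarrow> real^2 \<Rightarrow> (real^2 \<Rightarrow> real^2) \<Rightarrow> bool" where
  "local_lift r f x F \<longleftrightarrow>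
     (\<exists>S. open S \<and> x \<in> S \<and> Ck_on r S F \<and> (\<forall>y\<in>S. torus_proj (F y) = f (torus_proj y)))"

definition Cr_maps :: "nat \<Rightarrow> (torus \<Rightarrow> torus) set" where
  "Cr_maps r = {f. \<forall>x. \<exists>F. local_lift r f x F}"

lemma Cr_maps_Suc_subset: "Cr_maps (Suc r) \<subseteq> Cr_maps r"
  unfolding Cr_maps_def local_lift_def using Ck_on_Suc_imp by blast

text \<open>Uniform closeness of all derivatives of order at most \<open>r\<close>, in the norm of multilinear maps.
  For order \<open>0\<close>, the choice of the lifts makes this closeness in the flat distance of the torus.\<close>
definition Cr_close :: "nat \<Rightarrow> real \<Rightarrow> (torus \<Rightarrow> torus) \<Rightarrow> (torus \<Rightarrow> torus) \<Rightarrow> bool" where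
  "Cr_close r e f g \<longleftrightarrow>
     (\<forall>x. \<exists>F G. local_lift r f x F \<and> local_lift r g x G \<and>
        (\<forall>vs. length vs \<le> r \<longrightarrow> (\<forall>v\<in>set vs. norm v = 1) \<longrightarrow>
           norm (iter_deriv vs F x - iter_deriv vs G x) < e))"

lemma Cr_close_mono: "Cr_close r d f g \<Longrightarrow> d \<le> e \<Longrightarrow> Cr_close r e f g"
  unfolding Cr_close_def by (meson less_le_trans)

definition Cr_topology :: "nat \<Rightarrow> (torus \<Rightarrow> torus) topology" where
  "Cr_topology r = topology (\<lambda>U. U \<subseteq> Cr_maps r \<and>
     (\<forall>f\<in>U. \<exists>e>0. \<forall>g\<in>Cr_maps r. Cr_close r e f g \<longrightarrow> g \<in> U))"

lemma openin_Cr_topology: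
  "openin (Cr_topology r) U \<longleftrightarrow> U \<subseteq> Cr_maps r \<and>
     (\<forall>f\<in>U. \<exists>e>0. \<forall>g\<in>Cr_maps r. Cr_close r e f g \<longrightarrow> g \<in> U)"
proof -
  have "istopology (\<lambda>U. U \<subseteq> Cr_maps r \<and>
     (\<forall>f\<in>U. \<exists>e>0. \<forall>g\<in>Cr_maps r. Cr_close r e f g \<longrightarrow> g \<in> U))" (is "istopology ?P")
    unfolding istopology_def
  proof (intro conjI allI impI)
    fix A B assume A: "?P A" and B: "?P B"
    show "A \<inter> B \<subseteq> Cr_maps r" using A by blast
    show "\<forall>f\<in>A \<inter> B. \<exists>e>0. \<forall>g\<in>Cr_maps r. Cr_close r e f g \<longrightarrow> g \<in> A \<inter> B"
    proof
      fix f assume f: "f \<in> A \<inter> B"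
      obtain a where a: "a > 0" "\<forall>g\<in>Cr_maps r. Cr_close r a f g \<longrightarrow> g \<in> A" using A f by blast
      obtain b where b: "b > 0" "\<forall>g\<in>Cr_maps r. Cr_close r b f g \<longrightarrow> g \<in> B" using B f by blast
      have "\<forall>g\<in>Cr_maps r. Cr_close r (min a b) f g \<longrightarrow> g \<in> A \<inter> B"
        using a(2) b(2) Cr_close_mono[of r "min a b"] by (metis Int_iff min.cobounded1 min.cobounded2)
      then show "\<exists>e>0. \<forall>g\<in>Cr_maps r. Cr_close r e f g \<longrightarrow> g \<in> A \<inter> B"
        using a(1) b(1) by (intro exI[of _ "min a b"]) simp
    qed
  next
    fix K assume K: "\<forall>A\<in>K. ?P A"
    show "\<Union>K \<subseteq> Cr_maps r" using K by blast
    show "\<forall>f\<in>\<Union>K. \<exists>e>0. \<forall>g\<in>Cr_maps r. Cr_close r e f g \<longrightarrow> g \<in> \<Union>K"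
      using K by (meson UnionE UnionI)
  qed
  then show ?thesis
    unfolding Cr_topology_def by (simp add: topology_inverse')
qed

lemma topspace_Cr_topology: "topspace (Cr_topology r) = Cr_maps r"
proof (rule antisym)
  show "topspace (Cr_topology r) \<subseteq> Cr_maps r"
    using openin_topspace openin_Cr_topology by blast
  show "Cr_maps r \<subseteq> topspace (Cr_topology r)"
    by (rule openin_subset) (auto simp: openin_Cr_topology intro: exI[of _ 1])
qed

definition transitive :: "('a::topological_space \<Rightarrow> 'a) \<Rightarrow> bool" where
  "transitive g \<longleftrightarrow>
     (\<forall>U V. open U \<and> U \<noteq> {} \<and> open V \<and> V \<noteq> {} \<longrightarrow> (\<exists>n\<ge>1. (g ^^ n) ` U \<inter> V \<noteq> {}))"

definition robustly_transitive :: "nat \<Rightarrow> (torus \<Rightarrow> torus) \<Rightarrow> bool" where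
  "robustly_transitive r f \<longleftrightarrow>
     f \<in> Cr_maps r \<and> (\<exists>\<U>. openin (Cr_topology r) \<U> \<and> f \<in> \<U> \<and> (\<forall>g\<in>\<U>. transitive g))"

end

theory Submission
  imports Defs
begin

text \<open>The example is the skew product with lift
  \<open>(x, y) \<mapsto> (10\<^sup>6 x, F (x, y))\<close>, where
  \<open>F (x, y) = 20 (4 sin 2\<pi>y + 3 cos 2\<pi>x (1 - cos 2\<pi>y))\<close>. Two features of \<open>F\<close> matter.

  Its maximum is \<open>160\<close> (as \<open>4\<^sup>2 + 3\<^sup>2 = 5\<^sup>2\<close>), an integer, and the circle \<open>y = 0\<close> is invariant. At the
  maximum \<open>160 - F\<close> vanishes together with its gradient, so an arbitrarily \<open>C\<^sup>1\<close>-small change makes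
  \<open>F\<close> constant there on an open set while the circle stays invariant. That open set is then mapped into
  the invariant circle and never leaves it, so the changed map is not transitive
  (\<open>flattened_close\<close>, \<open>flattened_not_transitive\<close>).

  On the other hand \<open>F\<^sub>y\<close> and \<open>F\<^sub>y\<^sub>y\<close> are never small at the same time (\<open>slope_or_curv_large\<close>), so
  every critical point of every fibre map is a nondegenerate fold, and this persists under
  \<open>C\<^sup>2\<close>-small perturbations. Let \<open>G\<close> be the lift of a perturbation. As the horizontal expansion is huge, nearly
  horizontal cones are preserved. Fix \<open>N\<close>; the level sets of the first coordinate of \<open>G\<^sup>N\<close> are then
  vertical Lipschitz graphs, and so are their images under \<open>G\<^sup>i\<close> for \<open>i \<le> N\<close>. Such a curve of height \<open>r\<close>
  has an image of height at least of the order of \<open>r\<^sup>2\<close>, even across a fold (\<open>fold_estimate\<close>), and where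
  \<open>F\<^sub>y\<close> is large its height is multiplied by at least \<open>64\<close>. Inside any open set take a horizontal segment. After
  \<open>n\<close> steps it is long, so from then on a point of it can be chosen to stay where \<open>F\<^sub>y\<close> is large, and to
  arrive at time \<open>N\<close> above any prescribed \<open>x\<close> (\<open>itinerary\<close>). The vertical curve through that point keeps a
  positive height for \<open>n\<close> steps, with a bound that is independent of \<open>N\<close>, and then grows until it covers
  a full vertical circle, hence meets every point above \<open>x\<close>
  (\<open>iterate_of_box_hits_lattice_translate\<close>).\<close>

section \<open>Two mean value estimates\<close>

lemma lipschitz_from_derivative:
  fixes f f' :: "real \<Rightarrow> real"
  assumes "\<And>x. (f has_real_derivative f' x) (at x)" and "\<And>x. \<bar>f' x\<bar> \<le> B"
  shows "\<bar>f x - f y\<bar> \<le> B * \<bar>x - y\<bar>"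
  using field_differentiable_bound[of UNIV f f' B x y] assms
  by (simp add: has_field_derivative_at_within)

lemma second_difference_ge:
  fixes \<phi> \<phi>' \<phi>'' :: "real \<Rightarrow> real"
  assumes d1: "\<And>t. (\<phi> has_real_derivative \<phi>' t) (at t)"
    and d2: "\<And>t. (\<phi>' has_real_derivative \<phi>'' t) (at t)"
    and lb: "\<And>t. \<bar>t\<bar> \<le> s \<Longrightarrow> c \<le> \<phi>'' t" and s: "0 \<le> s"
  shows "c * s\<^sup>2 \<le> \<phi> s + \<phi> (- s) - 2 * \<phi> 0"
proof -
  have odd: "c * (2 * t) \<le> \<phi>' t - \<phi>' (- t)" if t: "0 \<le> t" "t \<le> s" for t
  proof (cases "t = 0")
    case False
    then have "- t < t" using t by simp
    then obtain z where z: "- t < z" "z < t" "\<phi>' t - \<phi>' (- t) = (t - - t) * \<phi>'' z"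
      using MVT2[of "- t" t \<phi>' \<phi>''] d2 by blast
    have "c \<le> \<phi>'' z" using lb z t by simp
    then have "2 * t * c \<le> 2 * t * \<phi>'' z" using t by (intro mult_left_mono) auto
    then show ?thesis using z(3) by (simp add: algebra_simps)
  qed simp
  define \<psi> where "\<psi> t = \<phi> t + \<phi> (- t) - c * t\<^sup>2" for t
  have "(\<psi> has_real_derivative \<phi>' t - \<phi>' (- t) - c * (2 * t)) (at t)" for t
  proof -
    have "((\<lambda>t. \<phi> (- t)) has_real_derivative \<phi>' (- t) * (- 1)) (at t)"
      by (rule DERIV_chain2[OF d1]) (auto intro!: derivative_eq_intros)
    then show ?thesis
      unfolding \<psi>_def by (auto intro!: derivative_eq_intros d1)
  qed
  moreover have "0 \<le> \<phi>' t - \<phi>' (- t) - c * (2 * t)" if "0 \<le> t" "t \<le> s" for t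
    using odd[OF that] by simp
  ultimately have "\<psi> 0 \<le> \<psi> s"
    using DERIV_nonneg_imp_nondecreasing[OF s, of \<psi>] by blast
  then show ?thesis by (simp add: \<psi>_def)
qed

section \<open>The model map\<close>

definition pt :: "real \<Rightarrow> real \<Rightarrow> real^2" where
  "pt x y = x *\<^sub>R axis 1 1 + y *\<^sub>R axis 2 1"

lemma pt_nth [simp]: "pt x y $ 1 = x" "pt x y $ 2 = y"
  by (simp_all add: pt_def axis_def)

lemma norm_vec2_le: "norm (v :: real^2) \<le> \<bar>v $ 1\<bar> + \<bar>v $ 2\<bar>"
  using norm_le_l1_cart[of v] by (simp add: sum_2)

lemma norm_vec2_sq: "(norm (v :: real^2))\<^sup>2 = (v $ 1)\<^sup>2 + (v $ 2)\<^sup>2"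
  unfolding power2_norm_eq_inner by (simp add: inner_vec_def sum_2 power2_eq_square)

definition fib :: "real \<Rightarrow> real \<Rightarrow> real" where
  "fib x y = 20 * (4 * sin (2*pi*y) + 3 * cos (2*pi*x) * (1 - cos (2*pi*y)))"

definition model :: "real^2 \<Rightarrow> real^2" where
  "model p = pt (1000000 * p $ 1) (fib (p $ 1) (p $ 2))"

text \<open>Up to the factors \<open>40\<pi>\<close> and \<open>80\<pi>\<^sup>2\<close>, the functions \<open>slope\<close> and \<open>curv\<close> are the first and second
  derivative of \<open>fib\<close> in \<open>y\<close>.\<close>

definition slope :: "real \<Rightarrow> real \<Rightarrow> real" where
  "slope x y = 4 * cos (2*pi*y) + 3 * cos (2*pi*x) * sin (2*pi*y)"

definition curv :: "real \<Rightarrow> real \<Rightarrow> real" where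
  "curv x y = 3 * cos (2*pi*x) * cos (2*pi*y) - 4 * sin (2*pi*y)"

lemma fib_dy: "(fib x has_real_derivative 40 * pi * slope x y) (at y)"
  unfolding fib_def slope_def
  by (auto intro!: derivative_eq_intros simp: algebra_simps)

lemma fib_dx: "((\<lambda>x. fib x y) has_real_derivative
    - 120 * pi * sin (2*pi*x) * (1 - cos (2*pi*y))) (at x)"
  unfolding fib_def
  by (auto intro!: derivative_eq_intros simp: algebra_simps)

lemma abs_sin_mult_le: "\<bar>a\<bar> \<le> B \<Longrightarrow> \<bar>a * sin t\<bar> \<le> (B::real)"
  and abs_cos_mult_le: "\<bar>a\<bar> \<le> B \<Longrightarrow> \<bar>a * cos t\<bar> \<le> (B::real)"
  using mult_mono[of "\<bar>a\<bar>" B "\<bar>sin t\<bar>" 1] mult_mono[of "\<bar>a\<bar>" B "\<bar>cos t\<bar>" 1]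
  by (auto simp: abs_mult)

lemma abs_slope_le: "\<bar>slope x y\<bar> \<le> 7" and abs_curv_le: "\<bar>curv x y\<bar> \<le> 7"
  using abs_cos_mult_le[of 4 4 "2*pi*y"] abs_sin_mult_le[of 4 4 "2*pi*y"]
    abs_sin_mult_le[OF abs_cos_mult_le[of 3 3 "2*pi*x"], of "2*pi*y"]
    abs_cos_mult_le[OF abs_cos_mult_le[of 3 3 "2*pi*x"], of "2*pi*y"]
  unfolding slope_def curv_def by linarith+

lemma fib_lipschitz: "\<bar>fib x y - fib x' y'\<bar> \<le> 960 * \<bar>x - x'\<bar> + 1120 * \<bar>y - y'\<bar>"
proof -
  have "\<bar>- 120 * pi * sin (2*pi*t) * (1 - cos (2*pi*y))\<bar> \<le> 960" for t
  proof -
    have "\<bar>sin (2*pi*t)\<bar> * \<bar>1 - cos (2*pi*y)\<bar> \<le> 1 * 2"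
      using cos_ge_minus_one[of "2*pi*y"] by (intro mult_mono) (auto simp: abs_le_iff)
    then have "120 * pi * (\<bar>sin (2*pi*t)\<bar> * \<bar>1 - cos (2*pi*y)\<bar>) \<le> 120 * 4 * (1*2)"
      using pi_less_4 by (intro mult_mono) auto
    then show ?thesis by (simp add: abs_mult)
  qed
  then have 1: "\<bar>fib x y - fib x' y\<bar> \<le> 960 * \<bar>x - x'\<bar>"
    by (intro lipschitz_from_derivative[OF fib_dx])
  have "\<bar>40 * pi * slope x' t\<bar> \<le> 1120" for t
  proof -
    have "40 * pi * \<bar>slope x' t\<bar> \<le> 40 * 4 * 7"
      using pi_less_4 abs_slope_le[of x' t] by (intro mult_mono) auto
    then show ?thesis by (simp add: abs_mult)
  qed
  then have "\<bar>fib x' y - fib x' y'\<bar> \<le> 1120 * \<bar>y - y'\<bar>"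
    by (intro lipschitz_from_derivative[OF fib_dy])
  with 1 show ?thesis by linarith
qed

lemma slope_dy: "(slope x has_real_derivative 2 * pi * curv x y) (at y)"
  unfolding slope_def curv_def
  by (auto intro!: derivative_eq_intros simp: algebra_simps)

lemma slope_dx: "((\<lambda>x. slope x y) has_real_derivative
    2 * pi * (- 3 * sin (2*pi*x) * sin (2*pi*y))) (at x)"
  unfolding slope_def
  by (auto intro!: derivative_eq_intros simp: algebra_simps)

lemma curv_dy: "(curv x has_real_derivative 2 * pi * (- slope x y)) (at y)"
  unfolding slope_def curv_def
  by (auto intro!: derivative_eq_intros simp: algebra_simps)

lemma curv_dx: "((\<lambda>x. curv x y) has_real_derivative
    2 * pi * (- 3 * sin (2*pi*x) * cos (2*pi*y))) (at x)"
  unfolding curv_def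
  by (auto intro!: derivative_eq_intros simp: algebra_simps)

lemma two_pi_mult_le: "\<bar>a\<bar> \<le> B \<Longrightarrow> \<bar>2 * pi * a\<bar> \<le> 8 * B"
  using mult_mono[of "2 * pi" 8 "\<bar>a\<bar>" B] pi_less_4 by (auto simp: abs_mult)

lemma slope_lipschitz: "\<bar>slope x y - slope x' y'\<bar> \<le> 24 * \<bar>x - x'\<bar> + 56 * \<bar>y - y'\<bar>"
proof -
  have "\<bar>slope x y - slope x' y\<bar> \<le> 24 * \<bar>x - x'\<bar>"
    using two_pi_mult_le[OF abs_sin_mult_le[OF abs_sin_mult_le[of "- 3" 3]]]
    by (intro lipschitz_from_derivative[OF slope_dx]) (simp add: abs_mult)
  moreover have "\<bar>slope x' y - slope x' y'\<bar> \<le> 56 * \<bar>y - y'\<bar>"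
    using two_pi_mult_le[OF abs_curv_le]
    by (intro lipschitz_from_derivative[OF slope_dy]) auto
  ultimately show ?thesis by linarith
qed

lemma curv_lipschitz: "\<bar>curv x y - curv x' y'\<bar> \<le> 24 * \<bar>x - x'\<bar> + 56 * \<bar>y - y'\<bar>"
proof -
  have "\<bar>curv x y - curv x' y\<bar> \<le> 24 * \<bar>x - x'\<bar>"
    using two_pi_mult_le[OF abs_cos_mult_le[OF abs_sin_mult_le[of "- 3" 3]]]
    by (intro lipschitz_from_derivative[OF curv_dx]) (simp add: abs_mult)
  moreover have "\<bar>curv x' y - curv x' y'\<bar> \<le> 56 * \<bar>y - y'\<bar>"
    using two_pi_mult_le[of "- slope x' _" 7] abs_slope_le[of x']
    by (intro lipschitz_from_derivative[OF curv_dy]) (auto simp del: mult_minus_right)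
  ultimately show ?thesis by linarith
qed

text \<open>The sum of squares of \<open>slope\<close> and \<open>curv\<close> is \<open>16 + 9 cos\<^sup>2 2\<pi>x\<close>, the square of the amplitude of
  the sinusoid \<open>fib x / 20\<close>.\<close>

lemma slope_or_curv_large: "2 \<le> \<bar>slope x y\<bar> \<or> 3 \<le> \<bar>curv x y\<bar>"
proof (rule ccontr)
  assume "\<not> ?thesis"
  then have "\<bar>slope x y\<bar>\<^sup>2 < 2\<^sup>2" "\<bar>curv x y\<bar>\<^sup>2 < 3\<^sup>2"
    by (intro power_strict_mono; simp)+
  moreover define c s C where "c = cos (2*pi*y)" and "s = sin (2*pi*y)" and "C = cos (2*pi*x)"
  have "(slope x y)\<^sup>2 + (curv x y)\<^sup>2 = (16 + 9 * C\<^sup>2) * (s\<^sup>2 + c\<^sup>2)"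
    unfolding slope_def curv_def c_def[symmetric] s_def[symmetric] C_def[symmetric] by algebra
  then have "(slope x y)\<^sup>2 + (curv x y)\<^sup>2 = 16 + 9 * C\<^sup>2"
    by (simp add: s_def c_def)
  ultimately show False
    using zero_le_power2[of C] by simp
qed

text \<open>At these two abscissae the slope is \<open>4c \<plusminus> 3s\<close> with \<open>c\<^sup>2 + s\<^sup>2 = 1\<close>. So the fold curves avoid each
  given height somewhere, which is what lets an orbit avoid the folds.\<close>

lemma slope_large_at_half_integers:
  assumes "j \<in> \<int>"
  shows "3 \<le> \<bar>slope j y\<bar> \<or> 3 \<le> \<bar>slope (j + 1/2) y\<bar>"
proof -
  define c s where "c = cos (2*pi*y)" and "s = sin (2*pi*y)"
  have "cos (2*pi*j) = 1" "sin (2*pi*j) = 0"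
    using assms by (auto simp: cos_one_2pi_int sin_integer_2pi cos_integer_2pi)
  moreover have "2*pi*(j + 1/2) = 2*pi*j + pi" by (simp add: algebra_simps)
  ultimately have e: "slope j y = 4 * c + 3 * s" "slope (j + 1/2) y = 4 * c - 3 * s"
    by (auto simp: slope_def c_def s_def cos_add)
  have "(\<bar>c\<bar> + \<bar>s\<bar>)\<^sup>2 = s\<^sup>2 + c\<^sup>2 + 2 * \<bar>c\<bar> * \<bar>s\<bar>"
    by (simp add: power2_sum)
  then have "1\<^sup>2 \<le> (\<bar>c\<bar> + \<bar>s\<bar>)\<^sup>2"
    by (simp add: c_def s_def)
  then have "1 \<le> \<bar>c\<bar> + \<bar>s\<bar>"
    using power2_le_imp_le by (metis abs_ge_zero add_nonneg_nonneg)
  then show ?thesis unfolding e by linarith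
qed

text \<open>The hypothesis on \<open>x'\<close> keeps the horizontal variation of \<open>fib\<close>, at most \<open>9.6 \<bar>y' - y\<bar>\<close>, small
  against the vertical one, at least \<open>80 \<bar>y' - y\<bar>\<close>.\<close>

lemma fib_expands:
  assumes "2 \<le> \<bar>slope x y\<bar>" and v: "\<bar>x' - x\<bar> \<le> \<bar>y' - y\<bar> / 100" and s: "\<bar>y' - y\<bar> \<le> 1/64"
  shows "70 * \<bar>y' - y\<bar> \<le> \<bar>fib x' y' - fib x y\<bar>"
proof -
  have "80 * \<bar>y' - y\<bar> \<le> \<bar>fib x y' - fib x y\<bar>"
  proof (cases "y' = y")
    case False
    have "\<exists>z. \<bar>z - y\<bar> \<le> 1/64 \<and> fib x y' - fib x y = (y' - y) * (40 * pi * slope x z)"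
    proof (cases "y < y'")
      case True
      then show ?thesis
        using MVT2[OF True, of "fib x" "\<lambda>z. 40 * pi * slope x z"] fib_dy s
        by (smt (verit))
    next
      case False
      with \<open>y' \<noteq> y\<close> have "y' < y" by simp
      from MVT2[OF this, of "fib x" "\<lambda>z. 40 * pi * slope x z"] fib_dy
      obtain z where "y' < z" "z < y" "fib x y - fib x y' = (y - y') * (40 * pi * slope x z)"
        by blast
      then show ?thesis using s by (intro exI[of _ z]) (auto simp: algebra_simps)
    qed
    then obtain z where z: "\<bar>z - y\<bar> \<le> 1/64" "fib x y' - fib x y = (y' - y) * (40 * pi * slope x z)"
      by blast
    have "1 \<le> \<bar>slope x z\<bar>"
      using slope_lipschitz[of x z x y] z(1) assms(1) by (simp add: abs_if split: if_splits)
    then have "40 * 2 * 1 \<le> 40 * pi * \<bar>slope x z\<bar>"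
      using pi_ge_two by (intro mult_mono) auto
    then have "80 \<le> \<bar>40 * pi * slope x z\<bar>" by (simp add: abs_mult)
    then show ?thesis
      unfolding z(2) abs_mult[of "y' - y"] by (simp add: mult.commute mult_left_mono)
  qed simp
  moreover have "\<bar>fib x' y' - fib x y'\<bar> \<le> 960 * \<bar>x' - x\<bar>"
    using fib_lipschitz[of x' y' x y'] by simp
  moreover have "\<bar>fib x y' - fib x y\<bar> \<le> \<bar>fib x' y' - fib x y\<bar> + \<bar>fib x' y' - fib x y'\<bar>"
    by linarith
  ultimately show ?thesis
    using v abs_ge_zero[of "y' - y"] by argo
qed

text \<open>Along a nearly vertical segment the second derivative of \<open>fib\<close> is dominated by
  \<open>80 \<pi>\<^sup>2 curv \<beta>\<^sup>2\<close>; the mixed and horizontal terms are collected in \<open>m\<close>.\<close>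

lemma fib_second_difference:
  assumes c: "3 \<le> \<bar>curv a b\<bar>" and u: "\<bar>u\<bar> \<le> \<bar>\<beta>\<bar> / 100"
    and x: "\<And>t. \<bar>t\<bar> \<le> 1 \<Longrightarrow> \<bar>x + t * u - a\<bar> \<le> 1/6400"
    and y: "\<And>t. \<bar>t\<bar> \<le> 1 \<Longrightarrow> \<bar>y + t * \<beta> - b\<bar> \<le> 1/64"
  shows "200 * \<beta>\<^sup>2 \<le> \<bar>fib (x + u) (y + \<beta>) + fib (x - u) (y - \<beta>) - 2 * fib x y\<bar>"
proof -
  define \<phi> where "\<phi> t = fib (x + t * u) (y + t * \<beta>)" for t
  define \<phi>' where "\<phi>' t = 40 * pi * (slope (x + t*u) (y + t*\<beta>) * \<beta>
      - 3 * u * sin (2*pi*(x + t*u)) * (1 - cos (2*pi*(y + t*\<beta>))))" for t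
  define m where "m t = - 6 * u * \<beta> * sin (2*pi*(x + t*u)) * sin (2*pi*(y + t*\<beta>))
      - 3 * u\<^sup>2 * cos (2*pi*(x + t*u)) * (1 - cos (2*pi*(y + t*\<beta>)))" for t
  define \<phi>'' where "\<phi>'' t = 80 * pi\<^sup>2 * (curv (x + t*u) (y + t*\<beta>) * \<beta>\<^sup>2 + m t)" for t
  have d1: "(\<phi> has_real_derivative \<phi>' t) (at t)" for t
    unfolding \<phi>_def \<phi>'_def fib_def slope_def
    by (auto intro!: derivative_eq_intros simp: algebra_simps)
  have d2: "(\<phi>' has_real_derivative \<phi>'' t) (at t)" for t
    unfolding \<phi>'_def \<phi>''_def m_def curv_def slope_def
    by (auto intro!: derivative_eq_intros) (simp add: algebra_simps power2_eq_square)
  have u\<beta>: "\<bar>u * \<beta>\<bar> \<le> \<beta>\<^sup>2 / 100" "u\<^sup>2 \<le> \<beta>\<^sup>2 / 10000"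
  proof -
    have "\<bar>u\<bar> * \<bar>\<beta>\<bar> \<le> (\<bar>\<beta>\<bar>/100) * \<bar>\<beta>\<bar>" using u by (intro mult_right_mono) auto
    moreover have "\<bar>\<beta>\<bar> * \<bar>\<beta>\<bar> = \<beta>\<^sup>2" by (simp add: power2_eq_square)
    ultimately show "\<bar>u * \<beta>\<bar> \<le> \<beta>\<^sup>2 / 100" by (simp add: abs_mult)
    have "\<bar>u\<bar>\<^sup>2 \<le> (\<bar>\<beta>\<bar>/100)\<^sup>2" using u by (intro power_mono) auto
    then show "u\<^sup>2 \<le> \<beta>\<^sup>2 / 10000" by (simp add: power_divide)
  qed
  have m: "\<bar>m t\<bar> \<le> \<beta>\<^sup>2 / 10" for t
  proof -
    have "\<bar>- 6 * (u * \<beta>) * sin (2*pi*(x + t*u)) * sin (2*pi*(y + t*\<beta>))\<bar> \<le> 6 * \<beta>\<^sup>2 / 100"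
      (is "\<bar>?A\<bar> \<le> _")
      using u\<beta>(1) abs_mult[of "- 6" "u * \<beta>"] by (intro abs_sin_mult_le) linarith
    moreover have "\<bar>3 * u\<^sup>2 * cos (2*pi*(x + t*u)) * (1 - cos (2*pi*(y + t*\<beta>)))\<bar> \<le> 3 * (\<beta>\<^sup>2/10000) * 2"
      (is "\<bar>?B\<bar> \<le> _")
    proof -
      have "\<bar>3 * u\<^sup>2 * cos (2*pi*(x + t*u))\<bar> \<le> 3 * (\<beta>\<^sup>2/10000)"
        using u\<beta> by (intro abs_cos_mult_le) auto
      moreover have "\<bar>1 - cos (2*pi*(y + t*\<beta>))\<bar> \<le> 2"
        using cos_ge_minus_one[of "2*pi*(y + t*\<beta>)"] cos_le_one[of "2*pi*(y + t*\<beta>)"] by linarith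
      ultimately show ?thesis unfolding abs_mult[of _ "1 - _"] by (intro mult_mono) auto
    qed
    moreover have "m t = ?A - ?B" by (simp add: m_def mult.assoc)
    ultimately show ?thesis
      using zero_le_power2[of \<beta>] by linarith
  qed
  have near: "\<bar>curv (x + t*u) (y + t*\<beta>) - curv a b\<bar> \<le> 9/10" if "\<bar>t\<bar> \<le> 1" for t
    using curv_lipschitz[of "x + t*u" "y + t*\<beta>" a b] x[OF that] y[OF that] by argo
  have pi2: "320 \<le> 80 * pi\<^sup>2"
    using power_mono[OF pi_ge_two, of 2] by simp
  consider "3 \<le> curv a b" | "curv a b \<le> - 3" using c by linarith
  then show ?thesis
  proof cases
    case 1
    have "200 * \<beta>\<^sup>2 \<le> \<phi>'' t" if t: "\<bar>t\<bar> \<le> 1" for t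
    proof -
      have "2 * \<beta>\<^sup>2 \<le> curv (x + t*u) (y + t*\<beta>) * \<beta>\<^sup>2"
        using near[OF t, unfolded abs_le_iff] 1 by (intro mult_right_mono) auto
      then have "\<beta>\<^sup>2 \<le> curv (x + t*u) (y + t*\<beta>) * \<beta>\<^sup>2 + m t"
        using m[of t] zero_le_power2[of \<beta>] by linarith
      then have "320 * \<beta>\<^sup>2 \<le> \<phi>'' t"
        unfolding \<phi>''_def using pi2 by (intro mult_mono) auto
      then show ?thesis using zero_le_power2[of \<beta>] by linarith
    qed
    from second_difference_ge[of \<phi> \<phi>' \<phi>'' 1, OF d1 d2 this] show ?thesis
      by (simp add: \<phi>_def)
  next
    case 2
    have "200 * \<beta>\<^sup>2 \<le> - \<phi>'' t" if t: "\<bar>t\<bar> \<le> 1" for t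
    proof -
      have "2 * \<beta>\<^sup>2 \<le> - curv (x + t*u) (y + t*\<beta>) * \<beta>\<^sup>2"
        using near[OF t, unfolded abs_le_iff] 2 by (intro mult_right_mono) auto
      then have "\<beta>\<^sup>2 \<le> - (curv (x + t*u) (y + t*\<beta>) * \<beta>\<^sup>2 + m t)"
        using m[of t] zero_le_power2[of \<beta>] by simp
      then have "320 * \<beta>\<^sup>2 \<le> 80 * pi\<^sup>2 * (- (curv (x + t*u) (y + t*\<beta>) * \<beta>\<^sup>2 + m t))"
        using pi2 by (intro mult_mono) auto
      then show ?thesis using zero_le_power2[of \<beta>] unfolding \<phi>''_def by linarith
    qed
    from second_difference_ge[of "\<lambda>t. - \<phi> t" "\<lambda>t. - \<phi>' t" "\<lambda>t. - \<phi>'' t" 1,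
        OF DERIV_minus[OF d1] DERIV_minus[OF d2] this] show ?thesis
      by (simp add: \<phi>_def)
  qed
qed

section \<open>Dynamics of small perturbations\<close>

text \<open>Covers increments of both signs, since a curve may leave its initial height upwards or downwards.\<close>

lemma ivt_abs:
  fixes f :: "real \<Rightarrow> real"
  assumes f: "continuous_on {c..d} f" and a: "a \<in> {c..d}" and r: "0 \<le> r" "r \<le> \<bar>f a - f c\<bar>"
  shows "\<exists>a'\<in>{c..a}. f a' - f c = (if f c \<le> f a then r else - r)"
proof (cases "f c \<le> f a")
  case True
  moreover have "continuous_on {c..a} f"
    using f by (rule continuous_on_subset) (use a in auto)
  ultimately obtain t where "c \<le> t" "t \<le> a" "f t = f c + r"
    using IVT'[of f c "f c + r" a] a r by auto
  then show ?thesis using True by (intro bexI[of _ t]) auto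
next
  case False
  moreover have "continuous_on {c..a} f"
    using f by (rule continuous_on_subset) (use a in auto)
  ultimately obtain t where "c \<le> t" "t \<le> a" "f t = f c - r"
    using IVT2'[of f a "f c - r" c] a r by auto
  then show ?thesis using False by (intro bexI[of _ t]) auto
qed

text \<open>The horizontal cone is oriented: \<open>hcone s p q\<close> forces \<open>q\<close> to lie to the right of \<open>p\<close>, so that the
  expansion of first coordinates can be stated without absolute values.\<close>

definition hcone :: "real \<Rightarrow> real^2 \<Rightarrow> real^2 \<Rightarrow> bool" where
  "hcone s p q \<longleftrightarrow> \<bar>q $ 2 - p $ 2\<bar> \<le> s * (q $ 1 - p $ 1)"

definition vert :: "real^2 \<Rightarrow> real^2 \<Rightarrow> bool" where
  "vert p q \<longleftrightarrow> \<bar>q $ 1 - p $ 1\<bar> \<le> \<bar>q $ 2 - p $ 2\<bar> / 100"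

text \<open>All that is used of \<open>C\<^sup>2\<close>-closeness is that the error \<open>G - model\<close> has small first differences and
  small symmetric second differences.\<close>

locale perturbation =
  fixes G :: "real^2 \<Rightarrow> real^2"
  assumes first_order:
      "\<bar>(G q - model q) $ i - (G p - model p) $ i\<bar> \<le> norm (q - p) / 2"
    and second_order:
      "\<bar>(G (p + e) - model (p + e)) $ i + (G (p - e) - model (p - e)) $ i
          - 2 * (G p - model p) $ i\<bar> \<le> (norm e)\<^sup>2 / 2"
begin

lemma first_coord: "\<bar>G q $ 1 - G p $ 1 - 1000000 * (q $ 1 - p $ 1)\<bar>
    \<le> (\<bar>q $ 1 - p $ 1\<bar> + \<bar>q $ 2 - p $ 2\<bar>) / 2"
proof -
  have "G q $ 1 - G p $ 1 - 1000000 * (q $ 1 - p $ 1) = (G q - model q) $ 1 - (G p - model p) $ 1"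
    by (simp add: model_def algebra_simps)
  then show ?thesis
    using first_order[of q 1 p] norm_vec2_le[of "q - p"] unfolding vector_minus_component by argo
qed

lemma second_coord: "\<bar>(G q $ 2 - G p $ 2) - (fib (q $ 1) (q $ 2) - fib (p $ 1) (p $ 2))\<bar>
    \<le> (\<bar>q $ 1 - p $ 1\<bar> + \<bar>q $ 2 - p $ 2\<bar>) / 2"
proof -
  have "(G q $ 2 - G p $ 2) - (fib (q $ 1) (q $ 2) - fib (p $ 1) (p $ 2))
      = (G q - model q) $ 2 - (G p - model p) $ 2"
    by (simp add: model_def algebra_simps)
  then show ?thesis
    using first_order[of q 2 p] norm_vec2_le[of "q - p"] unfolding vector_minus_component by argo
qed

lemma second_coord_lipschitz:
  "\<bar>G q $ 2 - G p $ 2\<bar> \<le> 961 * \<bar>q $ 1 - p $ 1\<bar> + 1121 * \<bar>q $ 2 - p $ 2\<bar>"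
  using second_coord[of q p] fib_lipschitz[of "q $ 1" "q $ 2" "p $ 1" "p $ 2"]
  by argo

lemma continuous_G: "continuous_on UNIV G"
proof -
  have "norm (G q - G p) \<le> 2000000 * norm (q - p)" for p q
  proof -
    have "\<bar>q $ 1 - p $ 1\<bar> \<le> norm (q - p)" "\<bar>q $ 2 - p $ 2\<bar> \<le> norm (q - p)"
      using component_le_norm_cart[of "q - p" 1] component_le_norm_cart[of "q - p" 2] by auto
    moreover have "norm (G q - G p) \<le> \<bar>G q $ 1 - G p $ 1\<bar> + \<bar>G q $ 2 - G p $ 2\<bar>"
      using norm_vec2_le[of "G q - G p"] by simp
    moreover have "\<bar>1000000 * (q $ 1 - p $ 1)\<bar> = 1000000 * \<bar>q $ 1 - p $ 1\<bar>"
      unfolding abs_mult by simp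
    ultimately show ?thesis
      using first_coord[of q p] second_coord_lipschitz[of q p] norm_ge_zero[of "q - p"]
        abs_triangle_ineq2[of "G q $ 1 - G p $ 1" "1000000 * (q $ 1 - p $ 1)"]
      by argo
  qed
  then have "2000000-lipschitz_on UNIV G"
    by (intro lipschitz_onI) (auto simp: dist_norm)
  then show ?thesis by (rule lipschitz_on_continuous_on)
qed

lemma continuous_iterate: "continuous_on UNIV (G ^^ n)"
proof (induction n)
  case (Suc n)
  have "continuous_on UNIV (G \<circ> (G ^^ n))"
    using Suc continuous_G by (intro continuous_on_compose) (auto intro: continuous_on_subset)
  then show ?case by simp
qed simp

text \<open>A single computation covers the two cones in use: slope \<open>1/100\<close> for images of horizontal segments,
  and slope \<open>100\<close>, whose complement consists of the vertical pairs.\<close>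

lemma hcone_step:
  assumes c: "hcone s p q" and s: "1/100 \<le> s" "s \<le> 100"
  shows "hcone s (G p) (G q) \<and> 100000 * (q $ 1 - p $ 1) \<le> G q $ 1 - G p $ 1"
proof -
  define u v where "u = q $ 1 - p $ 1" and "v = \<bar>q $ 2 - p $ 2\<bar>"
  have v: "0 \<le> v" "v \<le> s * u" using c by (auto simp: hcone_def u_def v_def)
  then have "0 \<le> s * u" by linarith
  then have u: "0 \<le> u" using s by (simp add: zero_le_mult_iff)
  then have su: "u / 100 \<le> s * u" "s * u \<le> 100 * u" using s mult_right_mono[of "1/100" s u]
    by (auto intro: mult_right_mono)
  have "\<bar>G q $ 1 - G p $ 1 - 1000000 * u\<bar> \<le> (u + v) / 2"
    using first_coord[of q p] u by (simp add: u_def v_def)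
  then have 1: "999949 * u \<le> G q $ 1 - G p $ 1"
    using v su by argo
  have "\<bar>G q $ 2 - G p $ 2\<bar> \<le> 961 * u + 1121 * v"
    using second_coord_lipschitz[of q p] u by (simp add: u_def v_def)
  also have "\<dots> \<le> 999949 * (s * u)"
    using v su by linarith
  also have "\<dots> = s * (999949 * u)" by simp
  also have "\<dots> \<le> s * (G q $ 1 - G p $ 1)"
    using 1 s by (intro mult_left_mono) auto
  finally show ?thesis using 1 u by (auto simp: hcone_def u_def)
qed

lemma hcone_iterate:
  assumes c: "hcone s p q" and s: "1/100 \<le> s" "s \<le> 100"
  shows "hcone s ((G ^^ n) p) ((G ^^ n) q) \<and>
    100000^n * (q $ 1 - p $ 1) \<le> (G ^^ n) q $ 1 - (G ^^ n) p $ 1"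
proof (induction n)
  case 0
  then show ?case using c by simp
next
  case (Suc n)
  have "100000 * (100000^n * (q $ 1 - p $ 1)) \<le> 100000 * ((G ^^ n) q $ 1 - (G ^^ n) p $ 1)"
    using Suc by (intro mult_left_mono) auto
  then show ?case
    using hcone_step[OF _ s, of "(G ^^ n) p" "(G ^^ n) q"] Suc by fastforce
qed

text \<open>Two points not in vertical position lie in a horizontal cone, and then their first coordinates
  separate for ever.\<close>

lemma vert_of_equal_first_coord:
  assumes e: "(G ^^ n) p $ 1 = (G ^^ n) q $ 1"
  shows "vert p q"
proof (rule ccontr)
  assume nv: "\<not> vert p q"
  have *: False if "hcone 100 p q" "p $ 1 < q $ 1" "(G ^^ n) p $ 1 = (G ^^ n) q $ 1" for p q
  proof -
    have "0 < 100000^n * (q $ 1 - p $ 1)" using that by simp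
    then show False using hcone_iterate[OF that(1), of n] that(3) by simp
  qed
  show False
  proof (cases "p $ 1 < q $ 1")
    case True
    then show False using *[of p q] nv e by (simp add: hcone_def vert_def)
  next
    case False
    then have "q $ 1 < p $ 1" "hcone 100 q p"
      using nv unfolding hcone_def vert_def by argo+
    then show False using *[of q p] e by simp
  qed
qed

lemma vert_iterates:
  assumes "(G ^^ n) p $ 1 = (G ^^ n) q $ 1" and "m \<le> n"
  shows "vert ((G ^^ m) p) ((G ^^ m) q)"
proof (rule vert_of_equal_first_coord[of "n - m"])
  have "(G ^^ (n - m)) ((G ^^ m) r) = (G ^^ n) r" for r
    using assms(2) by (metis comp_apply funpow_add le_add_diff_inverse2)
  then show "(G ^^ (n - m)) ((G ^^ m) p) $ 1 = (G ^^ (n - m)) ((G ^^ m) q) $ 1"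
    using assms(1) by simp
qed

text \<open>A substitute for an invariant vertical foliation: level sets of the first coordinate of a fixed
  iterate. They are graphs over the vertical axis, by monotonicity on horizontal lines, and Lipschitz
  because they contain only vertical pairs.\<close>

lemma vertical_curve:
  fixes b :: real
  shows "\<exists>X. X (p $ 2) = p $ 1 \<and> continuous_on {p $ 2..p $ 2 + b} X \<and>
    (\<forall>y\<in>{p $ 2..p $ 2 + b}. (G ^^ n) (pt (X y) y) $ 1 = (G ^^ n) p $ 1)"
proof -
  have "\<exists>x. (G ^^ n) (pt x y) $ 1 = (G ^^ n) p $ 1" if y: "p $ 2 \<le> y" for y
  proof -
    define w where "w = (y - p $ 2) / 100"
    have "hcone 100 p (pt (p $ 1 + w) y)" "hcone 100 (pt (p $ 1 - w) y) p"
      using y by (auto simp: hcone_def w_def)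
    from this[THEN hcone_iterate, of n]
    have "100000^n * w \<le> (G ^^ n) (pt (p $ 1 + w) y) $ 1 - (G ^^ n) p $ 1"
      "100000^n * w \<le> (G ^^ n) p $ 1 - (G ^^ n) (pt (p $ 1 - w) y) $ 1"
      by auto
    moreover have w: "0 \<le> w" using y by (simp add: w_def)
    then have "0 \<le> 100000^n * w" by simp
    ultimately have "(G ^^ n) (pt (p $ 1 - w) y) $ 1 \<le> (G ^^ n) p $ 1"
        "(G ^^ n) p $ 1 \<le> (G ^^ n) (pt (p $ 1 + w) y) $ 1"
      by linarith+
    moreover have "continuous_on A (\<lambda>x. (G ^^ n) (pt x y) $ 1)" for A
    proof -
      have "continuous_on A (\<lambda>x. (G ^^ n) (pt x y))"
        by (rule continuous_on_compose2[OF continuous_iterate])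
          (auto simp: pt_def intro!: continuous_intros)
      then show ?thesis by (intro continuous_intros)
    qed
    ultimately show ?thesis
      using IVT'[of "\<lambda>x. (G ^^ n) (pt x y) $ 1" "p $ 1 - w" "(G ^^ n) p $ 1" "p $ 1 + w"] w by auto
  qed
  then have "\<exists>X. \<forall>y. p $ 2 \<le> y \<longrightarrow> (G ^^ n) (pt (X y) y) $ 1 = (G ^^ n) p $ 1"
    by metis
  then obtain X where X: "(G ^^ n) (pt (X y) y) $ 1 = (G ^^ n) p $ 1" if "p $ 2 \<le> y" for y
    by blast
  have v: "\<bar>X y' - X y\<bar> \<le> \<bar>y' - y\<bar> / 100" if "p $ 2 \<le> y" "p $ 2 \<le> y'" for y y'
    using vert_of_equal_first_coord[of n "pt (X y) y" "pt (X y') y'"] X[OF that(1)] X[OF that(2)]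
    by (simp add: vert_def)
  have "(1/100)-lipschitz_on {p $ 2..p $ 2 + b} X"
    by (intro lipschitz_onI) (use v in \<open>auto simp: dist_real_def\<close>)
  then have "continuous_on {p $ 2..p $ 2 + b} X"
    by (rule lipschitz_on_continuous_on)
  moreover have "X (p $ 2) = p $ 1"
    using vert_of_equal_first_coord[of n "pt (X (p $ 2)) (p $ 2)" p] X[of "p $ 2"]
    by (simp add: vert_def)
  ultimately show ?thesis using X by (intro exI[of _ X]) auto
qed

lemma vertical_expansion:
  assumes "2 \<le> \<bar>slope (p $ 1) (p $ 2)\<bar>" "vert p q" "\<bar>q $ 2 - p $ 2\<bar> \<le> 1/64"
  shows "64 * \<bar>q $ 2 - p $ 2\<bar> \<le> \<bar>G q $ 2 - G p $ 2\<bar>"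
proof -
  have "70 * \<bar>q $ 2 - p $ 2\<bar> \<le> \<bar>fib (q $ 1) (q $ 2) - fib (p $ 1) (p $ 2)\<bar>"
    using assms by (intro fib_expands) (auto simp: vert_def)
  moreover have "\<bar>fib (q $ 1) (q $ 2) - fib (p $ 1) (p $ 2)\<bar> \<le> \<bar>G q $ 2 - G p $ 2\<bar> +
      \<bar>(G q $ 2 - G p $ 2) - (fib (q $ 1) (q $ 2) - fib (p $ 1) (p $ 2))\<bar>"
    by linarith
  ultimately show ?thesis
    using second_coord[of q p] assms(2) abs_ge_zero[of "q $ 2 - p $ 2"] unfolding vert_def by argo
qed

text \<open>Near a fold the height of a vertical curve can drop, but only quadratically. The three points
  \<open>p0, p1, p2\<close> of the curve have equally spaced heights. If their images had nearly equal second
  coordinates, they would also have nearly equal first coordinates, as the image is again vertical.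
  The second difference of the first coordinate then shows that \<open>p0\<close> nearly coincides with the
  reflection \<open>r\<close> of \<open>p2\<close> in \<open>p1\<close>, and this contradicts the lower bound on the second difference of
  \<open>fib\<close> at \<open>r, p1, p2\<close>.\<close>

lemma fold_estimate:
  assumes c: "3 \<le> \<bar>curv (p0 $ 1) (p0 $ 2)\<bar>"
    and \<beta>: "p1 $ 2 - p0 $ 2 = \<beta>" "p2 $ 2 - p0 $ 2 = 2 * \<beta>" "\<bar>\<beta>\<bar> \<le> 1/128"
    and v: "vert p0 p1" "vert p1 p2" "vert p0 p2"
    and v': "vert (G p0) (G p1)" "vert (G p0) (G p2)"
  shows "\<beta>\<^sup>2 \<le> \<bar>G p1 $ 2 - G p0 $ 2\<bar> \<or> \<beta>\<^sup>2 \<le> \<bar>G p2 $ 2 - G p0 $ 2\<bar>"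
proof (rule ccontr)
  assume "\<not> ?thesis"
  then have \<eta>: "\<bar>G p1 $ 2 - G p0 $ 2\<bar> < \<beta>\<^sup>2" "\<bar>G p2 $ 2 - G p0 $ 2\<bar> < \<beta>\<^sup>2" by auto
  then have \<eta>1: "\<bar>G p1 $ 1 - G p0 $ 1\<bar> \<le> \<beta>\<^sup>2 / 100" "\<bar>G p2 $ 1 - G p0 $ 1\<bar> \<le> \<beta>\<^sup>2 / 100"
    using v' unfolding vert_def by argo+
  define e where "e = p2 - p1"
  define r where "r = p1 - e"
  have e2: "e $ 2 = \<beta>" using \<beta> by (simp add: e_def)
  have e1: "\<bar>e $ 1\<bar> \<le> \<bar>\<beta>\<bar> / 100" using v(2) \<beta> by (simp add: vert_def e_def)
  have r2: "r $ 2 = p0 $ 2" using \<beta> e2 by (simp add: r_def)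
  have ne: "(norm e)\<^sup>2 \<le> 2 * \<beta>\<^sup>2"
  proof -
    have "\<bar>e $ 1\<bar>\<^sup>2 \<le> \<bar>\<beta>\<bar>\<^sup>2" using e1 by (intro power_mono) auto
    then show ?thesis by (simp add: norm_vec2_sq e2)
  qed
  have p2: "p1 + e = p2" by (simp add: e_def)
  have "G p2 $ 1 + G r $ 1 - 2 * G p1 $ 1 =
     (G p2 - model p2) $ 1 + (G r - model r) $ 1 - 2 * (G p1 - model p1) $ 1"
    by (simp add: model_def r_def e_def algebra_simps)
  then have s1: "\<bar>G p2 $ 1 + G r $ 1 - 2 * G p1 $ 1\<bar> \<le> \<beta>\<^sup>2"
    using second_order[of p1 e 1] ne unfolding p2 r_def[symmetric] by argo
  then have "\<bar>G r $ 1 - G p0 $ 1\<bar> \<le> 2 * \<beta>\<^sup>2"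
    using \<eta>1 zero_le_power2[of \<beta>] unfolding abs_le_iff by linarith
  moreover have "1000000 * \<bar>r $ 1 - p0 $ 1\<bar> \<le> \<bar>G r $ 1 - G p0 $ 1\<bar> + \<bar>r $ 1 - p0 $ 1\<bar> / 2"
  proof -
    have "\<bar>1000000 * (r $ 1 - p0 $ 1)\<bar> = 1000000 * \<bar>r $ 1 - p0 $ 1\<bar>" unfolding abs_mult by simp
    then show ?thesis using first_coord[of r p0] r2
      by (smt (verit) abs_zero)
  qed
  ultimately have r1: "99999 * \<bar>r $ 1 - p0 $ 1\<bar> \<le> \<beta>\<^sup>2"
    using abs_ge_zero[of "r $ 1 - p0 $ 1"] by simp
  have "\<bar>G r $ 2 - G p0 $ 2\<bar> \<le> 961 * \<bar>r $ 1 - p0 $ 1\<bar>"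
    using second_coord_lipschitz[of r p0] r2 by simp
  with r1 have s2: "\<bar>G r $ 2 - G p0 $ 2\<bar> \<le> \<beta>\<^sup>2"
    using abs_ge_zero[of "r $ 1 - p0 $ 1"] by linarith
  have "200 * \<beta>\<^sup>2 \<le> \<bar>fib (p1 $ 1 + e $ 1) (p1 $ 2 + \<beta>) + fib (p1 $ 1 - e $ 1) (p1 $ 2 - \<beta>)
      - 2 * fib (p1 $ 1) (p1 $ 2)\<bar>"
  proof (rule fib_second_difference[OF c e1])
    fix t :: real assume t: "\<bar>t\<bar> \<le> 1"
    have "\<bar>t * \<beta>\<bar> \<le> \<bar>\<beta>\<bar>" "\<bar>t * e $ 1\<bar> \<le> \<bar>e $ 1\<bar>"
      using t by (auto simp: abs_mult intro: mult_left_le_one_le)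
    moreover have "\<bar>p1 $ 1 - p0 $ 1\<bar> \<le> \<bar>\<beta>\<bar> / 100" using v(1) \<beta> by (simp add: vert_def)
    ultimately show "\<bar>p1 $ 1 + t * e $ 1 - p0 $ 1\<bar> \<le> 1/6400" "\<bar>p1 $ 2 + t * \<beta> - p0 $ 2\<bar> \<le> 1/64"
      using \<beta> e1 by (simp_all only: abs_le_iff) linarith+
  qed
  then have "200 * \<beta>\<^sup>2 \<le> \<bar>model p2 $ 2 + model r $ 2 - 2 * model p1 $ 2\<bar>"
    unfolding p2[symmetric] by (simp add: model_def r_def e2)
  moreover have "\<bar>(G p2 - model p2) $ 2 + (G r - model r) $ 2 - 2 * (G p1 - model p1) $ 2\<bar> \<le> \<beta>\<^sup>2"
    using second_order[of p1 e 2] ne unfolding p2 r_def[symmetric] by argo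
  moreover have "\<bar>model p2 $ 2 + model r $ 2 - 2 * model p1 $ 2\<bar> \<le> \<bar>G p2 $ 2 + G r $ 2 - 2 * G p1 $ 2\<bar>
      + \<bar>(G p2 - model p2) $ 2 + (G r - model r) $ 2 - 2 * (G p1 - model p1) $ 2\<bar>"
    using abs_triangle_ineq4[of "G p2 $ 2 + G r $ 2 - 2 * G p1 $ 2"
        "(G p2 - model p2) $ 2 + (G r - model r) $ 2 - 2 * (G p1 - model p1) $ 2"] by simp
  ultimately have "199 * \<beta>\<^sup>2 \<le> \<bar>G p2 $ 2 + G r $ 2 - 2 * G p1 $ 2\<bar>"
    by linarith
  moreover have "\<bar>G p2 $ 2 + G r $ 2 - 2 * G p1 $ 2\<bar> \<le> 4 * \<beta>\<^sup>2"
    using s2 \<eta> unfolding abs_le_iff abs_less_iff by linarith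
  ultimately have "\<beta>\<^sup>2 \<le> 0" by linarith
  then show False using \<eta>(1) by simp
qed

text \<open>The height of a curve is measured from its initial point \<open>T c\<close>, whose orbit will be chosen to avoid
  the folds. Curves higher than \<open>1/64\<close> are cut first, since the estimates of \<open>fib\<close> are local.\<close>

lemma height_step:
  fixes T :: "real \<Rightarrow> real^2"
  assumes T: "continuous_on {c..d} T"
    and v: "\<And>s t. s \<in> {c..d} \<Longrightarrow> t \<in> {c..d} \<Longrightarrow> vert (T s) (T t)"
    and v': "\<And>s t. s \<in> {c..d} \<Longrightarrow> t \<in> {c..d} \<Longrightarrow> vert (G (T s)) (G (T t))"
    and a: "a \<in> {c..d}" "r \<le> \<bar>T a $ 2 - T c $ 2\<bar>" and r: "0 < r"
  shows "\<exists>a'\<in>{c..d}. (min r (1/64) / 2)\<^sup>2 \<le> \<bar>G (T a') $ 2 - G (T c) $ 2\<bar>"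
    and "2 \<le> \<bar>slope (T c $ 1) (T c $ 2)\<bar> \<Longrightarrow>
      \<exists>a'\<in>{c..d}. min (64 * r) 1 \<le> \<bar>G (T a') $ 2 - G (T c) $ 2\<bar>"
proof -
  define m where "m = min r (1/64)"
  have m: "0 < m" "m \<le> r" "m \<le> 1/64" using r by (auto simp: m_def)
  define \<sigma> :: real where "\<sigma> = (if T c $ 2 \<le> T a $ 2 then 1 else - 1)"
  have T2: "continuous_on {c..d} (\<lambda>t. T t $ 2)"
    using T by (intro continuous_intros)
  have ivt: "\<exists>t\<in>{c..a}. T t $ 2 - T c $ 2 = \<sigma> * \<theta>" if "0 \<le> \<theta>" "\<theta> \<le> m" for \<theta>
  proof -
    have "\<theta> \<le> \<bar>T a $ 2 - T c $ 2\<bar>" using that m a by linarith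
    from ivt_abs[OF T2 a(1) that(1) this] show ?thesis
      unfolding \<sigma>_def by (auto split: if_splits)
  qed
  have "\<exists>t\<in>{c..a}. T t $ 2 - T c $ 2 = \<sigma> * (m / 2)" "\<exists>t\<in>{c..a}. T t $ 2 - T c $ 2 = \<sigma> * m"
    by (rule ivt; use m in simp)+
  then obtain a1 a2 where "a1 \<in> {c..a}" "a2 \<in> {c..a}"
    and "T a1 $ 2 - T c $ 2 = \<sigma> * (m / 2)" "T a2 $ 2 - T c $ 2 = \<sigma> * m"
    by blast
  then have a12: "a1 \<in> {c..d}" "a2 \<in> {c..d}"
      "T a1 $ 2 - T c $ 2 = \<sigma> * (m / 2)" "T a2 $ 2 - T c $ 2 = \<sigma> * m"
    using a(1) by auto
  have \<sigma>: "\<bar>\<sigma> * t\<bar> = \<bar>t\<bar>" "(\<sigma> * t)\<^sup>2 = t\<^sup>2" for t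
    by (auto simp: \<sigma>_def abs_mult)
  have c: "c \<in> {c..d}" using a(1) by auto
  have expand: "64 * m \<le> \<bar>G (T a2) $ 2 - G (T c) $ 2\<bar>" if "2 \<le> \<bar>slope (T c $ 1) (T c $ 2)\<bar>"
    using vertical_expansion[OF that v[OF c a12(2)]] a12(4) \<sigma>(1)[of m] m by simp
  have m2: "(m / 2)\<^sup>2 \<le> 64 * m"
    using m mult_left_mono[of m 1 m] by (simp add: power2_eq_square)
  show "\<exists>a'\<in>{c..d}. (min r (1/64) / 2)\<^sup>2 \<le> \<bar>G (T a') $ 2 - G (T c) $ 2\<bar>"
    unfolding m_def[symmetric]
  proof (cases "2 \<le> \<bar>slope (T c $ 1) (T c $ 2)\<bar>")
    case True
    then show "\<exists>a'\<in>{c..d}. (m / 2)\<^sup>2 \<le> \<bar>G (T a') $ 2 - G (T c) $ 2\<bar>"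
      using expand m2 a12(2) by force
  next
    case False
    then have "3 \<le> \<bar>curv (T c $ 1) (T c $ 2)\<bar>"
      using slope_or_curv_large[of "T c $ 1" "T c $ 2"] by blast
    then have "(\<sigma> * (m/2))\<^sup>2 \<le> \<bar>G (T a1) $ 2 - G (T c) $ 2\<bar> \<or> (\<sigma> * (m/2))\<^sup>2 \<le> \<bar>G (T a2) $ 2 - G (T c) $ 2\<bar>"
      using a12 c \<sigma>(1)[of "m/2"] m by (intro fold_estimate v v') auto
    then show "\<exists>a'\<in>{c..d}. (m / 2)\<^sup>2 \<le> \<bar>G (T a') $ 2 - G (T c) $ 2\<bar>"
      unfolding \<sigma>(2) using a12 by blast
  qed
  assume "2 \<le> \<bar>slope (T c $ 1) (T c $ 2)\<bar>"
  from expand[OF this] a12(2) show "\<exists>a'\<in>{c..d}. min (64 * r) 1 \<le> \<bar>G (T a') $ 2 - G (T c) $ 2\<bar>"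
    by (intro bexI[of _ a2]) (auto simp: m_def min_def split: if_splits)
qed

text \<open>The lower bounds \<open>r i\<close> do not depend on \<open>N\<close>; so \<open>N\<close> can be chosen after the time \<open>i\<close> from which on
  the base point avoids the folds.\<close>

lemma heights_of_iterates:
  assumes T: "continuous_on {c..c + b} T" and b: "0 < b"
    and T2: "\<And>t. t \<in> {c..c + b} \<Longrightarrow> T t $ 2 = t"
    and same: "\<And>t. t \<in> {c..c + b} \<Longrightarrow> (G ^^ N) (T t) $ 1 = (G ^^ N) (T c) $ 1"
  defines "r \<equiv> \<lambda>i. ((\<lambda>r. (min r (1/64) / 2)\<^sup>2) ^^ i) b"
  shows "i \<le> N \<Longrightarrow> \<exists>a\<in>{c..c + b}. r i \<le> \<bar>(G ^^ i) (T a) $ 2 - (G ^^ i) (T c) $ 2\<bar>"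
    and "\<forall>j. i \<le> j \<and> j < N \<longrightarrow> 2 \<le> \<bar>slope ((G ^^ j) (T c) $ 1) ((G ^^ j) (T c) $ 2)\<bar> \<Longrightarrow> i + k \<le> N \<Longrightarrow>
      \<exists>a\<in>{c..c + b}. min (64 ^ k * r i) 1 \<le> \<bar>(G ^^ (i + k)) (T a) $ 2 - (G ^^ (i + k)) (T c) $ 2\<bar>"
proof -
  have r: "0 < r i" for i
    unfolding r_def by (induction i) (use b in \<open>auto\<close>)
  have cont: "continuous_on {c..c + b} (\<lambda>t. (G ^^ i) (T t))" for i
    by (rule continuous_on_compose2[OF continuous_iterate T]) auto
  have v: "vert ((G ^^ i) (T s)) ((G ^^ i) (T t))"
    if "i \<le> N" "s \<in> {c..c + b}" "t \<in> {c..c + b}" for i s t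
    using vert_iterates[of N "T s" "T t" i] same[of s] same[of t] that by simp
  show low: "\<exists>a\<in>{c..c + b}. r i \<le> \<bar>(G ^^ i) (T a) $ 2 - (G ^^ i) (T c) $ 2\<bar>" if "i \<le> N" for i
    using that
  proof (induction i)
    case 0
    then show ?case using T2[of c] T2[of "c + b"] b by (intro bexI[of _ "c + b"]) (auto simp: r_def)
  next
    case (Suc i)
    then obtain a where a: "a \<in> {c..c + b}" "r i \<le> \<bar>(G ^^ i) (T a) $ 2 - (G ^^ i) (T c) $ 2\<bar>"
      by auto
    have "\<exists>a'\<in>{c..c + b}. (min (r i) (1/64) / 2)\<^sup>2
        \<le> \<bar>G ((G ^^ i) (T a')) $ 2 - G ((G ^^ i) (T c)) $ 2\<bar>"
      using v[of i] v[of "Suc i"] Suc.prems by (intro height_step(1)[OF cont _ _ a r]) auto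
    then show ?case by (simp add: r_def)
  qed
  show "\<exists>a\<in>{c..c + b}. min (64 ^ k * r i) 1 \<le> \<bar>(G ^^ (i + k)) (T a) $ 2 - (G ^^ (i + k)) (T c) $ 2\<bar>"
    if good: "\<forall>j. i \<le> j \<and> j < N \<longrightarrow> 2 \<le> \<bar>slope ((G ^^ j) (T c) $ 1) ((G ^^ j) (T c) $ 2)\<bar>" and "i + k \<le> N"
    using that(2)
  proof (induction k)
    case 0
    then show ?case using low[of i] by (auto simp: min_le_iff_disj)
  next
    case (Suc k)
    define m where "m = min (64 ^ k * r i) 1"
    from Suc obtain a where a: "a \<in> {c..c + b}"
        "m \<le> \<bar>(G ^^ (i + k)) (T a) $ 2 - (G ^^ (i + k)) (T c) $ 2\<bar>"
      unfolding m_def by auto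
    have m: "0 < m" using r[of i] by (simp add: m_def)
    have "2 \<le> \<bar>slope ((G ^^ (i + k)) (T c) $ 1) ((G ^^ (i + k)) (T c) $ 2)\<bar>"
      using good Suc.prems by simp
    then have "\<exists>a'\<in>{c..c + b}. min (64 * m) 1
        \<le> \<bar>G ((G ^^ (i + k)) (T a')) $ 2 - G ((G ^^ (i + k)) (T c)) $ 2\<bar>"
      using v[of "i + k"] v[of "Suc (i + k)"] Suc.prems
      by (intro height_step(2)[OF cont _ _ a m]) auto
    moreover have "min (64 * m) 1 = min (64 ^ Suc k * r i) 1"
      by (simp add: m_def min_def)
    ultimately show ?case by simp
  qed
qed

text \<open>A nearly horizontal curve of width \<open>2\<close> crosses windows around an integer \<open>j\<close> and around \<open>j + 1/2\<close>, at
  almost the same height. In one of the windows the slope of \<open>fib\<close> is large at that height, and the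
  image of the part of the curve over this window has again width at least \<open>2\<close>.\<close>

lemma itinerary:
  fixes \<zeta> :: "real \<Rightarrow> real^2"
  assumes "continuous_on {\<alpha>..\<beta>} \<zeta>" and "\<alpha> \<le> \<beta>"
    and "\<And>s t. \<alpha> \<le> s \<Longrightarrow> s \<le> t \<Longrightarrow> t \<le> \<beta> \<Longrightarrow> hcone (1/100) (\<zeta> s) (\<zeta> t)"
    and "\<zeta> \<alpha> $ 1 + 2 \<le> \<zeta> \<beta> $ 1"
  shows "\<exists>t\<in>{\<alpha>..\<beta>}. (\<forall>i<m. 2 \<le> \<bar>slope ((G ^^ i) (\<zeta> t) $ 1) ((G ^^ i) (\<zeta> t) $ 2)\<bar>) \<and>
    (G ^^ m) (\<zeta> t) $ 1 - x \<in> \<int>"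
  using assms
proof (induction m arbitrary: \<zeta> \<alpha> \<beta>)
  case 0
  have "continuous_on {\<alpha>..\<beta>} (\<lambda>t. \<zeta> t $ 1)"
    using "0.prems"(1) by (intro continuous_intros)
  moreover have "\<zeta> \<alpha> $ 1 \<le> x + of_int \<lceil>\<zeta> \<alpha> $ 1 - x\<rceil>" "x + of_int \<lceil>\<zeta> \<alpha> $ 1 - x\<rceil> \<le> \<zeta> \<beta> $ 1"
    using "0.prems"(4) by linarith+
  ultimately obtain t where "\<alpha> \<le> t" "t \<le> \<beta>" "\<zeta> t $ 1 = x + of_int \<lceil>\<zeta> \<alpha> $ 1 - x\<rceil>"
    using IVT'[of "\<lambda>t. \<zeta> t $ 1" \<alpha> _ \<beta>] "0.prems"(2) by blast
  then show ?case by (intro bexI[of _ t]) auto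
next
  case (Suc m)
  note cont = Suc.prems(1) and cn = Suc.prems(3)
  have cont1: "continuous_on {s..\<beta>} (\<lambda>t. \<zeta> t $ 1)" if "\<alpha> \<le> s" for s
    by (rule continuous_on_subset[of "{\<alpha>..\<beta>}"]) (use cont that in \<open>auto intro!: continuous_intros\<close>)
  have mono: "\<zeta> s $ 1 \<le> \<zeta> t $ 1" if "\<alpha> \<le> s" "s \<le> t" "t \<le> \<beta>" for s t
    using cn[OF that] unfolding hcone_def by argo
  have reach: "\<exists>t. s \<le> t \<and> t \<le> \<beta> \<and> \<zeta> t $ 1 = v" if "\<alpha> \<le> s" "s \<le> \<beta>" "\<zeta> s $ 1 \<le> v" "v \<le> \<zeta> \<beta> $ 1" for s v
    using IVT'[of "\<lambda>t. \<zeta> t $ 1" s v \<beta>] cont1 that by auto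
  define j :: real where "j = of_int \<lceil>\<zeta> \<alpha> $ 1 + 1/50\<rceil>"
  have j: "\<zeta> \<alpha> $ 1 + 1/50 \<le> j" "j \<le> \<zeta> \<alpha> $ 1 + 1/50 + 1" "j \<in> \<int>"
    unfolding j_def by linarith+ simp
  obtain tj where tj: "\<alpha> \<le> tj" "tj \<le> \<beta>" "\<zeta> tj $ 1 = j"
    using reach[of \<alpha> j] j Suc.prems(2,4) by auto
  obtain z where z: "z = j \<or> z = j + 1/2" "3 \<le> \<bar>slope z (\<zeta> tj $ 2)\<bar>"
    using slope_large_at_half_integers[OF j(3)] by blast
  obtain t1 where t1: "\<alpha> \<le> t1" "t1 \<le> \<beta>" "\<zeta> t1 $ 1 = z - 1/50"
    using reach[of \<alpha> "z - 1/50"] j z(1) Suc.prems(2,4) by force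
  obtain t2 where t2: "t1 \<le> t2" "t2 \<le> \<beta>" "\<zeta> t2 $ 1 = z + 1/50"
    using reach[of t1 "z + 1/50"] j z(1) t1 Suc.prems(4) by force
  have good: "2 \<le> \<bar>slope (\<zeta> t $ 1) (\<zeta> t $ 2)\<bar>" if t: "t1 \<le> t" "t \<le> t2" for t
  proof -
    have x: "\<bar>\<zeta> t $ 1 - z\<bar> \<le> 1/50"
      using mono[of t1 t] mono[of t t2] t t1 t2 unfolding abs_le_iff by linarith
    have "\<bar>\<zeta> t $ 2 - \<zeta> tj $ 2\<bar> \<le> 1/100 * \<bar>\<zeta> t $ 1 - j\<bar>"
    proof (cases "t \<le> tj")
      case True
      then have "hcone (1/100) (\<zeta> t) (\<zeta> tj)" using cn t t1 tj by simp
      then show ?thesis unfolding hcone_def tj(3) by (simp add: abs_minus_commute)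
    next
      case False
      then have "hcone (1/100) (\<zeta> tj) (\<zeta> t)" using cn t t2 tj by simp
      then show ?thesis unfolding hcone_def tj(3) by (simp add: abs_minus_commute)
    qed
    also have "\<bar>\<zeta> t $ 1 - j\<bar> \<le> 52/100"
      using x z(1) by linarith
    finally have y: "\<bar>\<zeta> t $ 2 - \<zeta> tj $ 2\<bar> \<le> 52/10000" by simp
    show ?thesis
      using slope_lipschitz[of "\<zeta> t $ 1" "\<zeta> t $ 2" z "\<zeta> tj $ 2"] x y z(2) by argo
  qed
  have "\<exists>t\<in>{t1..t2}. (\<forall>i<m. 2 \<le> \<bar>slope ((G ^^ i) (G (\<zeta> t)) $ 1) ((G ^^ i) (G (\<zeta> t)) $ 2)\<bar>) \<and>
    (G ^^ m) (G (\<zeta> t)) $ 1 - x \<in> \<int>"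
  proof (rule Suc.IH)
    show "continuous_on {t1..t2} (\<lambda>t. G (\<zeta> t))"
      by (rule continuous_on_compose2[OF continuous_G continuous_on_subset[OF cont]])
        (use t1 t2 in auto)
    show "t1 \<le> t2" by fact
    show "hcone (1/100) (G (\<zeta> s)) (G (\<zeta> t))" if "t1 \<le> s" "s \<le> t" "t \<le> t2" for s t
      using hcone_step[OF cn, of s t] that t1 t2 by auto
    show "G (\<zeta> t1) $ 1 + 2 \<le> G (\<zeta> t2) $ 1"
      using hcone_step[OF cn, of t1 t2] t1 t2 by auto
  qed
  then obtain t where t: "t \<in> {t1..t2}"
      "\<forall>i<m. 2 \<le> \<bar>slope ((G ^^ i) (G (\<zeta> t)) $ 1) ((G ^^ i) (G (\<zeta> t)) $ 2)\<bar>"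
      "(G ^^ m) (G (\<zeta> t)) $ 1 - x \<in> \<int>"
    by blast
  have "2 \<le> \<bar>slope ((G ^^ i) (\<zeta> t) $ 1) ((G ^^ i) (\<zeta> t) $ 2)\<bar>" if "i < Suc m" for i
    using that good[of t] t by (cases i) (auto simp: funpow_Suc_right simp del: funpow.simps)
  moreover have "(G ^^ Suc m) (\<zeta> t) $ 1 - x \<in> \<int>"
    using t(3) by (simp add: funpow_Suc_right del: funpow.simps)
  ultimately show ?case using t(1) t1 t2 by (intro bexI[of _ t]) auto
qed

proposition iterate_of_box_hits_lattice_translate:
  fixes p :: "real^2"
  assumes b: "0 < b"
  shows "\<exists>q N. 1 \<le> N \<and> \<bar>q $ 1 - p $ 1\<bar> \<le> b \<and> \<bar>q $ 2 - p $ 2\<bar> \<le> b \<and>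
    (G ^^ N) q $ 1 - x \<in> \<int> \<and> (G ^^ N) q $ 2 - y \<in> \<int>"
proof -
  obtain n' where "4 / b < 100000 ^ n'"
    using real_arch_pow[of 100000 "4 / b"] by auto
  define n where "n = Suc n'"
  have n: "2 \<le> 100000 ^ n * (b / 2)"
    using \<open>4 / b < 100000 ^ n'\<close> b by (simp add: n_def field_simps)
  define r where "r = ((\<lambda>r. (min r (1/64) / 2)\<^sup>2) ^^ n) b"
  have "0 < ((\<lambda>r. (min r (1/64) / 2)\<^sup>2) ^^ i) b" for i
    by (induction i) (use b in auto)
  then have r: "0 < r" by (simp add: r_def)
  obtain k where "1 / r < 64 ^ k"
    using real_arch_pow[of 64 "1 / r"] by auto
  then have k: "1 \<le> 64 ^ k * r" using r by (simp add: field_simps)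
  define N where "N = n + k"
  define \<zeta> where "\<zeta> s = (G ^^ n) (pt s (p $ 2))" for s
  have cn: "hcone (1/100) (\<zeta> s) (\<zeta> t) \<and> 100000 ^ n * (t - s) \<le> \<zeta> t $ 1 - \<zeta> s $ 1" if "s \<le> t" for s t
    using hcone_iterate[of "1/100" "pt s (p $ 2)" "pt t (p $ 2)" n] that
    by (simp add: \<zeta>_def hcone_def)
  have "\<exists>t\<in>{p $ 1..p $ 1 + b/2}. (\<forall>i<k. 2 \<le> \<bar>slope ((G ^^ i) (\<zeta> t) $ 1) ((G ^^ i) (\<zeta> t) $ 2)\<bar>) \<and>
    (G ^^ k) (\<zeta> t) $ 1 - x \<in> \<int>"
  proof (rule itinerary)
    show "continuous_on {p $ 1..p $ 1 + b/2} \<zeta>"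
      unfolding \<zeta>_def by (rule continuous_on_compose2[OF continuous_iterate])
        (auto simp: pt_def intro!: continuous_intros)
    show "\<zeta> (p $ 1) $ 1 + 2 \<le> \<zeta> (p $ 1 + b/2) $ 1"
      using cn[of "p $ 1" "p $ 1 + b/2"] n b by simp
  qed (use b cn in auto)
  then obtain t where t: "t \<in> {p $ 1..p $ 1 + b/2}"
      "\<And>i. i < k \<Longrightarrow> 2 \<le> \<bar>slope ((G ^^ i) (\<zeta> t) $ 1) ((G ^^ i) (\<zeta> t) $ 2)\<bar>"
      "(G ^^ k) (\<zeta> t) $ 1 - x \<in> \<int>"
    by blast
  have \<zeta>: "(G ^^ i) (\<zeta> t) = (G ^^ (n + i)) (pt t (p $ 2))" for i
    unfolding \<zeta>_def by (metis add.commute comp_apply funpow_add)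
  obtain X where X: "X (p $ 2) = t" "continuous_on {p $ 2..p $ 2 + b} X"
      "\<And>y. y \<in> {p $ 2..p $ 2 + b} \<Longrightarrow> (G ^^ N) (pt (X y) y) $ 1 = (G ^^ N) (pt t (p $ 2)) $ 1"
    using vertical_curve[of "pt t (p $ 2)" b N] unfolding pt_nth by blast
  define T where "T y = pt (X y) y" for y
  have T: "continuous_on {p $ 2..p $ 2 + b} T" "T (p $ 2) = pt t (p $ 2)"
    unfolding T_def using X by (auto simp: pt_def intro!: continuous_intros)
  have good: "2 \<le> \<bar>slope ((G ^^ j) (T (p $ 2)) $ 1) ((G ^^ j) (T (p $ 2)) $ 2)\<bar>"
    if "n \<le> j" "j < N" for j
    using t(2)[of "j - n"] \<zeta>[of "j - n"] that T(2) by (simp add: N_def)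
  \<comment> \<open>The bound is \<open>1\<close> by the choice of \<open>k\<close>, so the final curve contains a full vertical period.\<close>
  have "\<exists>a\<in>{p $ 2..p $ 2 + b}. min (64 ^ k * r) 1
      \<le> \<bar>(G ^^ (n + k)) (T a) $ 2 - (G ^^ (n + k)) (T (p $ 2)) $ 2\<bar>"
    unfolding r_def
    by (rule heights_of_iterates(2)[OF T(1) b, of N]) (use X good in \<open>auto simp: T_def N_def\<close>)
  then obtain a where a: "a \<in> {p $ 2..p $ 2 + b}"
      "1 \<le> \<bar>(G ^^ N) (T a) $ 2 - (G ^^ N) (T (p $ 2)) $ 2\<bar>"
    using k by (auto simp: N_def)
  define f where "f s = (G ^^ N) (T s) $ 2" for s
  have f: "continuous_on {p $ 2..p $ 2 + b} f"
    unfolding f_def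
    by (intro continuous_intros continuous_on_compose2[OF continuous_iterate T(1)]) auto
  \<comment> \<open>The distance from \<open>f (p $ 2)\<close> to the next value congruent to \<open>y\<close>, in the direction of \<open>f a\<close>.\<close>
  define \<theta> where "\<theta> = (if f (p $ 2) \<le> f a then of_int \<lceil>f (p $ 2) - y\<rceil> - (f (p $ 2) - y)
      else (f (p $ 2) - y) - of_int \<lfloor>f (p $ 2) - y\<rfloor>)"
  have "0 \<le> \<theta>" "\<theta> \<le> 1"
    unfolding \<theta>_def by (simp_all split: if_split) linarith+
  moreover have "1 \<le> \<bar>f a - f (p $ 2)\<bar>" using a(2) by (simp add: f_def)
  ultimately obtain s where s: "s \<in> {p $ 2..a}"
      "f s - f (p $ 2) = (if f (p $ 2) \<le> f a then \<theta> else - \<theta>)"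
    using ivt_abs[OF f a(1), of \<theta>] by auto
  then have "f s - y = (if f (p $ 2) \<le> f a then of_int \<lceil>f (p $ 2) - y\<rceil> else of_int \<lfloor>f (p $ 2) - y\<rfloor>)"
    by (auto simp: \<theta>_def split: if_splits)
  then have "f s - y \<in> \<int>" by auto
  moreover have sb: "s \<in> {p $ 2..p $ 2 + b}" using s(1) a(1) by auto
  have "(G ^^ N) (T s) $ 1 = (G ^^ k) (\<zeta> t) $ 1"
    using X(3)[OF sb] \<zeta>[of k] by (simp add: T_def N_def)
  then have "(G ^^ N) (T s) $ 1 - x \<in> \<int>" using t(3) by simp
  moreover have "vert (T (p $ 2)) (T s)"
    using vert_of_equal_first_coord[of N "T (p $ 2)" "T s"] X(3)[OF sb] T(2) by (simp add: T_def)
  then have "\<bar>T s $ 1 - p $ 1\<bar> \<le> b"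
    using t(1) sb b X(1) unfolding vert_def T_def pt_nth atLeastAtMost_iff by argo
  moreover have "\<bar>T s $ 2 - p $ 2\<bar> \<le> b" using sb by (auto simp: T_def)
  moreover have "1 \<le> N" by (simp add: N_def n_def)
  ultimately show ?thesis unfolding f_def by blast
qed

end

section \<open>Lifts and the topology of torus maps\<close>

lemma Ck_on_imp_continuous_on: "Ck_on r S F \<Longrightarrow> continuous_on S F"
proof (induction r)
  case (Suc r)
  then show ?case using Ck_on_Suc_imp by blast
qed simp

lemma Ck_on_subset: "Ck_on r S F \<Longrightarrow> T \<subseteq> S \<Longrightarrow> Ck_on r T F"
  by (induction r arbitrary: F) (auto intro: continuous_on_subset)

lemma frechet_derivative_cong_eventually:
  assumes "\<forall>\<^sub>F y in nhds x. F y = F' y"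
  shows "frechet_derivative F (at x) = frechet_derivative F' (at x)"
proof -
  have "(F has_derivative D) (at x) \<longleftrightarrow> (F' has_derivative D) (at x)" for D
  proof -
    have ev: "\<forall>\<^sub>F y in at x. F y = F' y" "F x = F' x"
      using assms eventually_nhds_x_imp_x[OF assms] by (auto simp: eventually_at_filter elim: eventually_mono)
    then have ev': "\<forall>\<^sub>F y in at x. F' y = F y" by (auto elim: eventually_mono)
    show ?thesis
      using has_derivative_transform_eventually[OF _ ev(1) ev(2)]
        has_derivative_transform_eventually[OF _ ev' ev(2)[symmetric]] by blast
  qed
  then show ?thesis by (simp add: frechet_derivative_def)
qed

lemma iter_deriv_cong_eventually:
  "\<forall>\<^sub>F y in nhds x. F y = F' y \<Longrightarrow> iter_deriv vs F x = iter_deriv vs F' x"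
proof (induction vs arbitrary: F F')
  case Nil
  then show ?case using eventually_nhds_x_imp_x[OF Nil] by simp
next
  case (Cons v vs)
  have "\<forall>\<^sub>F y in nhds x. \<forall>\<^sub>F z in nhds y. F z = F' z"
    using Cons.prems by (simp add: eventually_eventually)
  then have "\<forall>\<^sub>F y in nhds x. frechet_derivative F (at y) v = frechet_derivative F' (at y) v"
    by eventually_elim (simp add: frechet_derivative_cong_eventually)
  then show ?case by (simp add: Cons.IH)
qed

lemma frechet_derivative_add_const:
  "frechet_derivative (\<lambda>y. F y + c) (at x) = frechet_derivative F (at x)"
proof -
  have "((\<lambda>y. F y + c) has_derivative D) (at x) \<longleftrightarrow> (F has_derivative D) (at x)" for D
    using has_derivative_add[OF _ has_derivative_const, of F D "at x" c]
      has_derivative_add[OF _ has_derivative_const, of "\<lambda>y. F y + c" D "at x" "- c"] by auto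
  then show ?thesis by (simp add: frechet_derivative_def)
qed

lemma iter_deriv_add_const:
  "iter_deriv vs (\<lambda>y. F y + c) x = iter_deriv vs F x + (if vs = [] then c else 0)"
  by (cases vs) (simp_all add: frechet_derivative_add_const)

lemma differentiable_cong_eventually:
  assumes "\<forall>\<^sub>F y in nhds x. F y = F' y" "F differentiable (at x)"
  shows "F' differentiable (at x)"
proof -
  have "\<forall>\<^sub>F y in at x. F y = F' y" "F x = F' x"
    using assms(1) eventually_nhds_x_imp_x[OF assms(1)]
    by (auto simp: eventually_at_filter elim: eventually_mono)
  then show ?thesis
    using assms(2) has_derivative_transform_eventually unfolding differentiable_def by blast
qed

lemma Ck_on_add_const: "Ck_on r S F \<Longrightarrow> Ck_on r S (\<lambda>y. F y + c)"
  by (cases r) (auto simp: frechet_derivative_add_const intro!: continuous_intros)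

lemma Ck_on_cong:
  assumes "open S" "\<And>x. x \<in> S \<Longrightarrow> F x = F' x" "Ck_on r S F"
  shows "Ck_on r S F'"
  using assms(2,3)
proof (induction r arbitrary: F F')
  case 0
  then show ?case by (auto cong: continuous_on_cong)
next
  case (Suc r)
  have ev: "\<forall>\<^sub>F y in nhds x. F y = F' y" if "x \<in> S" for x
    using Suc.prems(1) that assms(1) by (auto simp: eventually_nhds)
  have "Ck_on r S (\<lambda>x. frechet_derivative F' (at x) v)" for v
    by (rule Suc.IH[of "\<lambda>x. frechet_derivative F (at x) v"])
      (use Suc.prems frechet_derivative_cong_eventually[OF ev] in auto)
  then show ?case
    using Suc.prems(2) differentiable_cong_eventually[OF ev] by auto
qed

lemma Ck_on_local:
  assumes "\<And>x. x \<in> S \<Longrightarrow> \<exists>T. open T \<and> x \<in> T \<and> Ck_on r T F"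
  shows "Ck_on r S F"
  using assms
proof (induction r arbitrary: F)
  case 0
  have "isCont F x" if "x \<in> S" for x
    using "0.prems"[OF that] by (auto simp: continuous_on_eq_continuous_at)
  then show ?case by (simp add: continuous_at_imp_continuous_on)
next
  case (Suc r)
  have "Ck_on r S (\<lambda>x. frechet_derivative F (at x) v)" for v
  proof (rule Suc.IH)
    fix x assume "x \<in> S"
    then show "\<exists>T. open T \<and> x \<in> T \<and> Ck_on r T (\<lambda>x. frechet_derivative F (at x) v)"
      using Suc.prems[of x] by auto
  qed
  moreover have "F differentiable (at x)" if "x \<in> S" for x
    using Suc.prems[OF that] by auto
  ultimately show ?case by auto
qed

lemma torus_proj_add_int: "(\<And>i. c $ i \<in> \<int>) \<Longrightarrow> torus_proj (y + c) = torus_proj y"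
  by (simp add: torus_proj_eq_iff)

text \<open>The reason why a map close to a map with a global lift has a global lift as well: the value of the
  lift is the unique representative near the given lift.\<close>

lemma close_representatives_equal:
  assumes "torus_proj a = torus_proj b" "norm (a - b) < 1"
  shows "a = b"
proof -
  have "a $ i = b $ i" for i
  proof -
    have "\<bar>a $ i - b $ i\<bar> < 1"
      using component_le_norm_cart[of "a - b" i] assms(2) by simp
    moreover have "a $ i - b $ i \<in> \<int>" using assms(1) by (simp add: torus_proj_eq_iff)
    ultimately show ?thesis using Ints_nonzero_abs_less1[of "a $ i - b $ i"] by auto
  qed
  then show ?thesis by (simp add: vec_eq_iff)
qed

lemma local_lift_add_int:
  assumes "local_lift r f x F" "\<And>i. c $ i \<in> \<int>"
  shows "local_lift r f x (\<lambda>y. F y + c)"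
  using assms Ck_on_add_const[of r _ F c] torus_proj_add_int[of c]
  unfolding local_lift_def by metis

lemma local_lift_continuous: "local_lift r f x F \<Longrightarrow> isCont F x"
  unfolding local_lift_def using Ck_on_imp_continuous_on continuous_on_eq_continuous_at by blast

lemma local_lift_eventually:
  "local_lift r f x F \<Longrightarrow> \<forall>\<^sub>F y in nhds x. torus_proj (F y) = f (torus_proj y)"
  unfolding local_lift_def eventually_nhds by blast

lemma local_lift_proj: "local_lift r f x F \<Longrightarrow> torus_proj (F x) = f (torus_proj x)"
  unfolding local_lift_def by blast

lemma isCont_tendsto_nhds: "isCont f x \<Longrightarrow> (f \<longlongrightarrow> f x) (nhds x)"
  unfolding continuous_at by (simp only: tendsto_at_iff_tendsto_nhds)

text \<open>The difference is continuous and has integer coordinates, hence it is locally constant.\<close>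

lemma local_lifts_differ_by_integer:
  assumes F: "local_lift r f x F" and F': "local_lift r f x F'"
  shows "\<forall>\<^sub>F y in nhds x. F' y = F y + (F' x - F x)" and "(F' x - F x) $ i \<in> \<int>"
proof -
  have int: "(F' x - F x) $ i \<in> \<int>" for i
    using local_lift_proj[OF F] local_lift_proj[OF F'] torus_proj_eq_iff[of "F' x" "F x"] by simp
  then show "(F' x - F x) $ i \<in> \<int>" .
  have "isCont (\<lambda>y. F' y - F y) x"
    using F F' by (intro continuous_intros local_lift_continuous)
  from tendstoD[OF isCont_tendsto_nhds[OF this], of 1]
  have "\<forall>\<^sub>F y in nhds x. dist (F' y - F y) (F' x - F x) < 1" by simp
  with local_lift_eventually[OF F] local_lift_eventually[OF F']
  show "\<forall>\<^sub>F y in nhds x. F' y = F y + (F' x - F x)"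
  proof eventually_elim
    case (elim y)
    then have "torus_proj (F' y) = torus_proj (F y + (F' x - F x))"
      using torus_proj_add_int[OF int] by simp
    moreover have "norm (F' y - (F y + (F' x - F x))) < 1"
      using elim by (simp add: dist_norm algebra_simps)
    ultimately show ?case by (rule close_representatives_equal)
  qed
qed

lemma iter_deriv_local_lifts:
  assumes "local_lift r f x F" and "local_lift r f x F'"
  shows "iter_deriv vs F' x = iter_deriv vs F x + (if vs = [] then F' x - F x else 0)"
  using iter_deriv_cong_eventually[OF local_lifts_differ_by_integer(1)[OF assms]]
  by (simp add: iter_deriv_add_const)

lemma Cr_close_of_lift:
  assumes "Cr_close r e f g" and F: "local_lift r f x F"
  shows "\<exists>G. local_lift r g x G \<and> (\<forall>vs. length vs \<le> r \<longrightarrow> (\<forall>v\<in>set vs. norm v = 1) \<longrightarrow>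
    norm (iter_deriv vs F x - iter_deriv vs G x) < e)"
proof -
  obtain F' G where F': "local_lift r f x F'" and G: "local_lift r g x G"
    and close: "\<And>vs. length vs \<le> r \<Longrightarrow> \<forall>v\<in>set vs. norm v = 1 \<Longrightarrow>
      norm (iter_deriv vs F' x - iter_deriv vs G x) < e"
    using assms(1) unfolding Cr_close_def by blast
  define c where "c = F x - F' x"
  have "local_lift r g x (\<lambda>y. G y + c)"
    unfolding c_def by (intro local_lift_add_int G local_lifts_differ_by_integer(2)[OF F' F])
  moreover have "iter_deriv vs F x - iter_deriv vs (\<lambda>y. G y + c) x
      = iter_deriv vs F' x - iter_deriv vs G x" for vs
    unfolding iter_deriv_local_lifts[OF F' F] iter_deriv_add_const c_def by simp
  ultimately show ?thesis using close by (intro exI[of _ "\<lambda>y. G y + c"]) auto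
qed

lemma Cr_close_trans:
  assumes "Cr_close r d f g" "Cr_close r e g k"
  shows "Cr_close r (d + e) f k"
  unfolding Cr_close_def
proof
  fix x
  obtain F G where F: "local_lift r f x F" and G: "local_lift r g x G"
    and 1: "\<And>vs. length vs \<le> r \<Longrightarrow> \<forall>v\<in>set vs. norm v = 1 \<Longrightarrow>
      norm (iter_deriv vs F x - iter_deriv vs G x) < d"
    using assms(1) unfolding Cr_close_def by blast
  obtain K where K: "local_lift r k x K"
    and 2: "\<And>vs. length vs \<le> r \<Longrightarrow> \<forall>v\<in>set vs. norm v = 1 \<Longrightarrow>
      norm (iter_deriv vs G x - iter_deriv vs K x) < e"
    using Cr_close_of_lift[OF assms(2) G] by blast
  have "norm (iter_deriv vs F x - iter_deriv vs K x) < d + e"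
    if "length vs \<le> r" "\<forall>v\<in>set vs. norm v = 1" for vs
    using norm_triangle_lt[of "iter_deriv vs F x - iter_deriv vs G x"
        "iter_deriv vs G x - iter_deriv vs K x" "d + e"] 1[OF that] 2[OF that] by simp
  with F K show "\<exists>F K. local_lift r f x F \<and> local_lift r k x K \<and>
      (\<forall>vs. length vs \<le> r \<longrightarrow> (\<forall>v\<in>set vs. norm v = 1) \<longrightarrow>
        norm (iter_deriv vs F x - iter_deriv vs K x) < d + e)"
    by blast
qed

lemma Cr_close_refl:
  assumes "f \<in> Cr_maps r" "0 < e"
  shows "Cr_close r e f f"
  unfolding Cr_close_def
proof
  fix x
  obtain F where "local_lift r f x F" using assms(1) by (auto simp: Cr_maps_def)
  then show "\<exists>F G. local_lift r f x F \<and> local_lift r f x G \<and>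
      (\<forall>vs. length vs \<le> r \<longrightarrow> (\<forall>v\<in>set vs. norm v = 1) \<longrightarrow>
        norm (iter_deriv vs F x - iter_deriv vs G x) < e)"
    using assms(2) by (intro exI[of _ F]) simp
qed

text \<open>By the triangle inequality for closeness, the maps at distance less than \<open>e\<close> from \<open>f\<close> form an open
  set.\<close>

lemma robustly_transitive_iff:
  "robustly_transitive r f \<longleftrightarrow> f \<in> Cr_maps r \<and>
    (\<exists>e>0. \<forall>g\<in>Cr_maps r. Cr_close r e f g \<longrightarrow> transitive g)"
proof
  assume "robustly_transitive r f"
  then show "f \<in> Cr_maps r \<and> (\<exists>e>0. \<forall>g\<in>Cr_maps r. Cr_close r e f g \<longrightarrow> transitive g)"
    unfolding robustly_transitive_def openin_Cr_topology by meson
next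
  assume *: "f \<in> Cr_maps r \<and> (\<exists>e>0. \<forall>g\<in>Cr_maps r. Cr_close r e f g \<longrightarrow> transitive g)"
  then obtain e where f: "f \<in> Cr_maps r" and e: "0 < e"
      "\<And>g. g \<in> Cr_maps r \<Longrightarrow> Cr_close r e f g \<Longrightarrow> transitive g"
    by blast
  define U where "U = {g \<in> Cr_maps r. \<exists>d<e. Cr_close r d f g}"
  have "openin (Cr_topology r) U"
    unfolding openin_Cr_topology
  proof (intro conjI ballI)
    show "U \<subseteq> Cr_maps r" by (auto simp: U_def)
    fix g assume "g \<in> U"
    then obtain d where d: "d < e" "Cr_close r d f g" by (auto simp: U_def)
    have "k \<in> U" if "k \<in> Cr_maps r" "Cr_close r ((e - d) / 2) g k" for k
      using that Cr_close_trans[OF d(2) that(2)] d(1)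
      unfolding U_def by (auto intro!: exI[of _ "d + (e - d) / 2"] simp: field_simps)
    then show "\<exists>e'>0. \<forall>k\<in>Cr_maps r. Cr_close r e' g k \<longrightarrow> k \<in> U"
      using d(1) by (intro exI[of _ "(e - d) / 2"]) simp
  qed
  moreover have "f \<in> U"
    using f e(1) Cr_close_refl[OF f, of "e/2"] by (auto simp: U_def intro!: exI[of _ "e/2"])
  moreover have "transitive g" if "g \<in> U" for g
    using that e(2) Cr_close_mono[of r _ f g e] by (auto simp: U_def intro: less_imp_le)
  ultimately show "robustly_transitive r f"
    using f unfolding robustly_transitive_def by blast
qed

definition lifts :: "nat \<Rightarrow> (torus \<Rightarrow> torus) \<Rightarrow> (real^2 \<Rightarrow> real^2) \<Rightarrow> bool" where
  "lifts r f F \<longleftrightarrow> Ck_on r UNIV F \<and> (\<forall>y. torus_proj (F y) = f (torus_proj y))"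

lemma lifts_imp_local_lift: "lifts r f F \<Longrightarrow> local_lift r f x F"
  unfolding lifts_def local_lift_def by blast

lemma lifts_imp_Cr_maps: "lifts r f F \<Longrightarrow> f \<in> Cr_maps r"
  unfolding Cr_maps_def using lifts_imp_local_lift by blast

text \<open>At each point the lift takes the value of a local lift that is close there. By uniqueness of close
  representatives these values agree with each local lift on a neighbourhood.\<close>

lemma lift_of_close_map:
  assumes F: "lifts r f F" and close: "Cr_close r e f g" and e: "e \<le> 1/2"
  shows "\<exists>G. lifts r g G \<and> (\<forall>x vs. length vs \<le> r \<longrightarrow> (\<forall>v\<in>set vs. norm v = 1) \<longrightarrow>
    norm (iter_deriv vs F x - iter_deriv vs G x) < e)"
proof -
  obtain L where L: "\<And>x. local_lift r g x (L x)"
    and Lc: "\<And>x vs. length vs \<le> r \<Longrightarrow> \<forall>v\<in>set vs. norm v = 1 \<Longrightarrow>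
      norm (iter_deriv vs F x - iter_deriv vs (L x) x) < e"
    using Cr_close_of_lift[OF close lifts_imp_local_lift[OF F]] by metis
  define G where "G x = L x x" for x
  have Gc: "norm (F y - G y) < e" for y
    using Lc[of "[]" y] by (simp add: G_def)
  have Gp: "torus_proj (G y) = g (torus_proj y)" for y
    using local_lift_proj[OF L] by (simp add: G_def)
  have ev: "\<forall>\<^sub>F y in nhds x. L x y = G y" for x
  proof -
    have "isCont (\<lambda>y. norm (F y - L x y)) x"
      by (intro continuous_intros local_lift_continuous[OF lifts_imp_local_lift[OF F]]
          local_lift_continuous[OF L])
    from order_tendstoD(2)[OF isCont_tendsto_nhds[OF this], of e]
    have "\<forall>\<^sub>F y in nhds x. norm (F y - L x y) < e"
      using Gc[of x] by (simp add: G_def)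
    with local_lift_eventually[OF L[of x]] show ?thesis
    proof eventually_elim
      case (elim y)
      have "norm (L x y - G y) \<le> norm (F y - L x y) + norm (F y - G y)"
        using norm_triangle_ineq4[of "F y - G y" "F y - L x y"] by simp
      then have "norm (L x y - G y) < 1" using elim(2) Gc[of y] e by linarith
      then show ?case using elim(1) Gp[of y] by (intro close_representatives_equal) auto
    qed
  qed
  have "Ck_on r UNIV G"
  proof (rule Ck_on_local)
    fix x
    obtain S where S: "open S" "x \<in> S" "Ck_on r S (L x)"
      using L[of x] unfolding local_lift_def by blast
    obtain T where T: "open T" "x \<in> T" "\<And>y. y \<in> T \<Longrightarrow> L x y = G y"
      using ev[of x] unfolding eventually_nhds by blast
    have "Ck_on r (S \<inter> T) G"
      by (rule Ck_on_cong[OF _ _ Ck_on_subset[OF S(3)]]) (use S T in auto)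
    then show "\<exists>T. open T \<and> x \<in> T \<and> Ck_on r T G"
      using S T by (intro exI[of _ "S \<inter> T"]) auto
  qed
  moreover have "iter_deriv vs (L x) x = iter_deriv vs G x" for vs x
    by (rule iter_deriv_cong_eventually[OF ev])
  ultimately show ?thesis
    using Gp Lc by (intro exI[of _ G]) (auto simp: lifts_def)
qed

lemma directional_derivative_component:
  assumes "F differentiable (at (p + t *\<^sub>R v))"
  shows "((\<lambda>t. F (p + t *\<^sub>R v) $ i) has_real_derivative
    frechet_derivative F (at (p + t *\<^sub>R v)) v $ i) (at t)"
proof -
  let ?D = "frechet_derivative F (at (p + t *\<^sub>R v))"
  have D: "(F has_derivative ?D) (at (p + t *\<^sub>R v))"
    using assms by (simp add: frechet_derivative_works)
  have "((\<lambda>t. p + t *\<^sub>R v) has_derivative (\<lambda>h. h *\<^sub>R v)) (at t)"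
    by (auto intro!: derivative_eq_intros)
  from has_derivative_compose[OF this D]
  have "((\<lambda>t. F (p + t *\<^sub>R v)) has_derivative (\<lambda>h. ?D (h *\<^sub>R v))) (at t)" .
  then have "((\<lambda>t. F (p + t *\<^sub>R v) $ i) has_derivative (\<lambda>h. ?D (h *\<^sub>R v) $ i)) (at t)"
    by (rule bounded_linear.has_derivative[OF bounded_linear_vec_nth])
  moreover have "?D (h *\<^sub>R v) = h *\<^sub>R ?D v" for h
    using linear_frechet_derivative[OF assms] by (simp add: linear_cmul)
  ultimately show ?thesis
    by (simp add: has_field_derivative_def mult.commute[of _ "_ $ i"] mult_commute_abs)
qed

lemma first_order_closeness:
  fixes F G :: "real^2 \<Rightarrow> real^2"
  assumes C: "Ck_on 1 UNIV F" "Ck_on 1 UNIV G"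
    and close: "\<And>x v. norm v = 1 \<Longrightarrow> norm (iter_deriv [v] F x - iter_deriv [v] G x) < e"
  shows "\<bar>(G q - F q) $ i - (G p - F p) $ i\<bar> \<le> e * norm (q - p)"
proof (cases "p = q")
  case False
  define v where "v = sgn (q - p)"
  have v: "norm v = 1" "p + norm (q - p) *\<^sub>R v = q"
    using False by (simp_all add: v_def norm_sgn sgn_div_norm)
  define \<phi> where "\<phi> t = G (p + t *\<^sub>R v) $ i - F (p + t *\<^sub>R v) $ i" for t
  have "(\<phi> has_real_derivative iter_deriv [v] G (p + t *\<^sub>R v) $ i - iter_deriv [v] F (p + t *\<^sub>R v) $ i) (at t)" for t
    unfolding \<phi>_def iter_deriv.simps
    by (intro DERIV_diff directional_derivative_component) (use C in auto)
  moreover have "\<bar>iter_deriv [v] G x $ i - iter_deriv [v] F x $ i\<bar> \<le> e" for x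
    using close[OF v(1), of x] component_le_norm_cart[of "iter_deriv [v] F x - iter_deriv [v] G x" i]
    by (simp add: abs_minus_commute)
  ultimately have "\<bar>\<phi> (norm (q - p)) - \<phi> 0\<bar> \<le> e * \<bar>norm (q - p) - 0\<bar>"
    by (rule lipschitz_from_derivative)
  then show ?thesis using v(2) by (simp add: \<phi>_def)
qed simp

text \<open>The only place where second derivatives of the perturbed map enter.\<close>

lemma second_order_closeness:
  fixes F G :: "real^2 \<Rightarrow> real^2"
  assumes C: "Ck_on 2 UNIV F" "Ck_on 2 UNIV G"
    and close: "\<And>x v. norm v = 1 \<Longrightarrow> norm (iter_deriv [v, v] F x - iter_deriv [v, v] G x) < e"
  shows "\<bar>(G (p + u) - F (p + u)) $ i + (G (p - u) - F (p - u)) $ i - 2 * (G p - F p) $ i\<bar>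
    \<le> e * (norm u)\<^sup>2"
proof (cases "u = 0")
  case False
  define v where "v = sgn u"
  have v: "norm v = 1" "norm u *\<^sub>R v = u"
    using False by (simp_all add: v_def norm_sgn sgn_div_norm)
  have C2: "H differentiable (at x)" "(\<lambda>x. frechet_derivative H (at x) w) differentiable (at x)"
    if "Ck_on 2 UNIV H" for H :: "real^2 \<Rightarrow> real^2" and x w
    using that by (auto simp: numeral_2_eq_2)
  define \<phi> where "\<phi> t = G (p + t *\<^sub>R v) $ i - F (p + t *\<^sub>R v) $ i" for t
  define \<phi>' where "\<phi>' t = iter_deriv [v] G (p + t *\<^sub>R v) $ i - iter_deriv [v] F (p + t *\<^sub>R v) $ i" for t
  define \<phi>'' where "\<phi>'' t = iter_deriv [v, v] G (p + t *\<^sub>R v) $ i - iter_deriv [v, v] F (p + t *\<^sub>R v) $ i" for t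
  have d1: "(\<phi> has_real_derivative \<phi>' t) (at t)" for t
    unfolding \<phi>_def \<phi>'_def iter_deriv.simps
    by (intro DERIV_diff directional_derivative_component C2 C)
  have d2: "(\<phi>' has_real_derivative \<phi>'' t) (at t)" for t
    unfolding \<phi>'_def \<phi>''_def iter_deriv.simps
    by (intro DERIV_diff directional_derivative_component C2 C)
  have "\<bar>\<phi>'' t\<bar> \<le> e" for t
    using close[OF v(1), of "p + t *\<^sub>R v"]
      component_le_norm_cart[of "iter_deriv [v, v] F (p + t *\<^sub>R v) - iter_deriv [v, v] G (p + t *\<^sub>R v)" i]
    by (simp add: \<phi>''_def abs_minus_commute)
  then have b: "- e \<le> \<phi>'' t" "- e \<le> - \<phi>'' t" for t by (smt (verit))+
  have "- e * (norm u)\<^sup>2 \<le> \<phi> (norm u) + \<phi> (- norm u) - 2 * \<phi> 0"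
    using second_difference_ge[OF d1 d2 b(1)] by simp
  moreover have "- e * (norm u)\<^sup>2 \<le> (- \<phi> (norm u)) + (- \<phi> (- norm u)) - 2 * (- \<phi> 0)"
    using second_difference_ge[OF DERIV_minus[OF d1] DERIV_minus[OF d2] b(2)] by simp
  ultimately have "\<bar>\<phi> (norm u) + \<phi> (- norm u) - 2 * \<phi> 0\<bar> \<le> e * (norm u)\<^sup>2"
    by linarith
  then show ?thesis using v(2) by (simp add: \<phi>_def)
qed simp

section \<open>Smoothness of the model map\<close>

lemma Ck_on_SucI:
  assumes "\<And>x. (F has_derivative D x) (at x)" and "\<And>v. Ck_on r UNIV (\<lambda>x. D x v)"
  shows "Ck_on (Suc r) UNIV F"
proof -
  have "frechet_derivative F (at x) = D x" for x
    using frechet_derivative_at[OF assms(1)] by simp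
  then show ?thesis using assms by (auto simp: differentiable_def)
qed

lemma Ck_on_Suc_has_derivative:
  "Ck_on (Suc r) UNIV F \<Longrightarrow> (F has_derivative frechet_derivative F (at x)) (at x)"
  by (simp flip: frechet_derivative_works)

lemma Ck_on_const: "Ck_on r UNIV (\<lambda>x. c)"
  by (induction r arbitrary: c) auto

lemma Ck_on_bounded_linear: "bounded_linear f \<Longrightarrow> Ck_on r UNIV f"
  by (cases r) (auto intro!: Ck_on_SucI[of f "\<lambda>_. f"] Ck_on_const
    bounded_linear_imp_has_derivative linear_continuous_on simp del: Ck_on.simps(2))

lemma Ck_on_add: "Ck_on r UNIV f \<Longrightarrow> Ck_on r UNIV g \<Longrightarrow> Ck_on r UNIV (\<lambda>x. f x + g x)"
proof (induction r arbitrary: f g)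
  case (Suc r)
  show ?case
    by (rule Ck_on_SucI[OF has_derivative_add[OF Suc.prems[THEN Ck_on_Suc_has_derivative]]])
      (use Suc in auto)
qed (auto intro: continuous_intros)

lemma Ck_on_linear_compose:
  "bounded_linear L \<Longrightarrow> Ck_on r UNIV f \<Longrightarrow> Ck_on r UNIV (\<lambda>x. L (f x))"
proof (induction r arbitrary: f)
  case 0
  then show ?case
    by (auto intro: bounded_linear.continuous_on)
next
  case (Suc r)
  show ?case
    by (rule Ck_on_SucI[OF bounded_linear.has_derivative[OF Suc.prems(1)
            Ck_on_Suc_has_derivative[OF Suc.prems(2)]]])
      (use Suc in auto)
qed

lemma Ck_on_mult:
  fixes f g :: "'a::euclidean_space \<Rightarrow> real"
  shows "Ck_on r UNIV f \<Longrightarrow> Ck_on r UNIV g \<Longrightarrow> Ck_on r UNIV (\<lambda>x. f x * g x)"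
proof (induction r arbitrary: f g)
  case (Suc r)
  have f: "Ck_on r UNIV f" "\<And>v. Ck_on r UNIV (\<lambda>x. frechet_derivative f (at x) v)"
    using Ck_on_Suc_imp[OF Suc.prems(1)] Suc.prems(1) by auto
  have g: "Ck_on r UNIV g" "\<And>v. Ck_on r UNIV (\<lambda>x. frechet_derivative g (at x) v)"
    using Ck_on_Suc_imp[OF Suc.prems(2)] Suc.prems(2) by auto
  show ?case
    by (rule Ck_on_SucI[OF has_derivative_mult[OF Suc.prems[THEN Ck_on_Suc_has_derivative]]])
      (intro Ck_on_add Suc.IH f g)
qed (auto intro: continuous_intros)

lemma Ck_on_sin_cos:
  fixes f :: "'a::euclidean_space \<Rightarrow> real"
  shows "Ck_on r UNIV f \<Longrightarrow> Ck_on r UNIV (\<lambda>x. sin (f x)) \<and> Ck_on r UNIV (\<lambda>x. cos (f x))"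
proof (induction r arbitrary: f)
  case (Suc r)
  note D = Ck_on_Suc_has_derivative[OF Suc.prems]
  have f: "Ck_on r UNIV f" "\<And>v. Ck_on r UNIV (\<lambda>x. frechet_derivative f (at x) v)"
    using Ck_on_Suc_imp[OF Suc.prems] Suc.prems by auto
  have sc: "Ck_on r UNIV (\<lambda>x. sin (f x))" "Ck_on r UNIV (\<lambda>x. cos (f x))"
    using Suc.IH[OF f(1)] by auto
  have "((\<lambda>x. sin (f x)) has_derivative (\<lambda>v. frechet_derivative f (at x) v * cos (f x))) (at x)" for x
    by (rule has_derivative_sin[OF D])
  moreover have "((\<lambda>x. cos (f x)) has_derivative
      (\<lambda>v. frechet_derivative f (at x) v * (- 1 * sin (f x)))) (at x)" for x
    using has_derivative_cos[OF D, of x] by simp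
  ultimately show ?case
    by (intro conjI; elim Ck_on_SucI; intro Ck_on_mult f sc Ck_on_const)
qed (auto intro: continuous_intros)

lemma Ck_on_fib: "Ck_on r UNIV (\<lambda>p::real^2. fib (p $ 1) (p $ 2))"
proof -
  have arg: "Ck_on r UNIV (\<lambda>p::real^2. 2 * pi * p $ i)" for i
    by (intro Ck_on_mult Ck_on_const Ck_on_bounded_linear bounded_linear_vec_nth)
  have "fib (p $ 1) (p $ 2) = 20 * (4 * sin (2*pi*p $ 2) + 3 * cos (2*pi*p $ 1) * (1 + (- 1) * cos (2*pi*p $ 2)))"
    for p :: "real^2" by (simp add: fib_def)
  then show ?thesis
    by (rule ssubst[OF ext]) (intro Ck_on_add Ck_on_mult Ck_on_const
        Ck_on_sin_cos[OF arg, THEN conjunct1] Ck_on_sin_cos[OF arg, THEN conjunct2])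
qed

lemma bounded_linear_pt: "bounded_linear (\<lambda>x. pt x 0)" "bounded_linear (\<lambda>y. pt 0 y)"
  unfolding pt_def by (auto intro!: bounded_linear_intros)

lemma Ck_on_model: "Ck_on r UNIV model"
proof -
  have "model = (\<lambda>p. pt (1000000 * p $ 1) 0 + pt 0 (fib (p $ 1) (p $ 2)))"
    by (auto simp: model_def pt_def)
  then show ?thesis
    by (rule ssubst) (intro Ck_on_add Ck_on_linear_compose[OF bounded_linear_pt(1)]
        Ck_on_linear_compose[OF bounded_linear_pt(2)] Ck_on_fib Ck_on_mult Ck_on_const
        Ck_on_bounded_linear bounded_linear_vec_nth)
qed

lemma trig_cong_int:
  assumes "a - b \<in> \<int>"
  shows "sin (2*pi*a) = sin (2*pi*b)" "cos (2*pi*a) = cos (2*pi*b)"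
proof -
  have "2*pi*a = 2*pi*(a - b) + 2*pi*b" by (simp add: algebra_simps)
  then show "sin (2*pi*a) = sin (2*pi*b)" "cos (2*pi*a) = cos (2*pi*b)"
    using sin_integer_2pi[OF assms] cos_integer_2pi[OF assms] by (auto simp: sin_add cos_add)
qed

lemma fib_periodic: "x - x' \<in> \<int> \<Longrightarrow> y - y' \<in> \<int> \<Longrightarrow> fib x y = fib x' y'"
  unfolding fib_def using trig_cong_int[of x x'] trig_cong_int[of y y'] by simp

lemma surj_torus_proj: "\<exists>p. t = torus_proj p"
  using Quotient3_abs_rep[OF Quotient3_torus, of t] by metis

lemma lifts_ex:
  assumes F: "Ck_on r UNIV F"
    and int: "\<And>p q i. (\<And>i. p $ i - q $ i \<in> \<int>) \<Longrightarrow> F p $ i - F q $ i \<in> \<int>"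
  shows "\<exists>f. lifts r f F"
proof -
  have "torus_proj (F p) = torus_proj (F (rep_torus (torus_proj p)))" for p
  proof -
    have "torus_proj p = torus_proj (rep_torus (torus_proj p))"
      by (simp add: Quotient3_abs_rep[OF Quotient3_torus])
    then show ?thesis unfolding torus_proj_eq_iff using int by blast
  qed
  then show ?thesis
    using F unfolding lifts_def by (intro exI[of _ "\<lambda>t. torus_proj (F (rep_torus t))"]) auto
qed

lemma model_int:
  assumes "\<And>i. p $ i - q $ i \<in> \<int>"
  shows "model p $ i - model q $ i \<in> \<int>"
proof -
  have "1000000 * p $ 1 - 1000000 * q $ 1 = 1000000 * (p $ 1 - q $ 1)" by simp
  moreover have "1000000 * (p $ 1 - q $ 1) \<in> \<int>"
    by (intro Ints_mult assms) auto
  moreover have "fib (p $ 1) (p $ 2) = fib (q $ 1) (q $ 2)"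
    by (intro fib_periodic assms)
  ultimately show ?thesis
    using exhaust_2[of i] by (auto simp: model_def)
qed

lemma lifts_iterate:
  assumes "lifts r g G"
  shows "torus_proj ((G ^^ n) p) = (g ^^ n) (torus_proj p)"
  using assms by (induction n) (auto simp: lifts_def)

section \<open>Robust transitivity in the finer topology\<close>

lemma open_torus_contains_box:
  assumes "open U" "torus_proj p \<in> U"
  shows "\<exists>b>0. \<forall>q. \<bar>q $ 1 - p $ 1\<bar> \<le> b \<and> \<bar>q $ 2 - p $ 2\<bar> \<le> b \<longrightarrow> torus_proj q \<in> U"
proof -
  have "open (torus_proj -` U)" using assms(1) by (simp add: open_torus_def)
  then obtain e where e: "e > 0" "ball p e \<subseteq> torus_proj -` U"
    using assms(2) openE[of "torus_proj -` U" p] by auto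
  have "torus_proj q \<in> U" if "\<bar>q $ 1 - p $ 1\<bar> \<le> e/3" "\<bar>q $ 2 - p $ 2\<bar> \<le> e/3" for q
  proof -
    have "norm (q - p) < e" using norm_vec2_le[of "q - p"] that e(1) by simp
    then have "q \<in> ball p e" by (simp add: dist_norm norm_minus_commute)
    then show ?thesis using e(2) by auto
  qed
  then show ?thesis using e(1) by (intro exI[of _ "e/3"]) auto
qed

lemma transitive_of_perturbation:
  assumes g: "lifts r g G" and G: "perturbation G"
  shows "transitive g"
  unfolding transitive_def
proof (intro allI impI)
  fix U V :: "torus set"
  assume UV: "open U \<and> U \<noteq> {} \<and> open V \<and> V \<noteq> {}"
  obtain p where p: "torus_proj p \<in> U" using UV surj_torus_proj by (metis ex_in_conv)
  obtain z where z: "torus_proj z \<in> V" using UV surj_torus_proj by (metis ex_in_conv)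
  obtain b where b: "b > 0"
      "\<And>q. \<bar>q $ 1 - p $ 1\<bar> \<le> b \<Longrightarrow> \<bar>q $ 2 - p $ 2\<bar> \<le> b \<Longrightarrow> torus_proj q \<in> U"
    using open_torus_contains_box[of U p] UV p by blast
  obtain q N where q: "1 \<le> N" "\<bar>q $ 1 - p $ 1\<bar> \<le> b" "\<bar>q $ 2 - p $ 2\<bar> \<le> b"
      "(G ^^ N) q $ 1 - z $ 1 \<in> \<int>" "(G ^^ N) q $ 2 - z $ 2 \<in> \<int>"
    using perturbation.iterate_of_box_hits_lattice_translate[OF G b(1), of p "z $ 1" "z $ 2"] by blast
  have "torus_proj ((G ^^ N) q) = torus_proj z"
    using q(4,5) by (simp add: torus_proj_eq_iff forall_2)
  then have "(g ^^ N) (torus_proj q) \<in> V"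
    using z lifts_iterate[OF g, of N q] by simp
  then show "\<exists>n\<ge>1. (g ^^ n) ` U \<inter> V \<noteq> {}"
    using q(1) b(2)[OF q(2,3)] by (intro exI[of _ N]) auto
qed

lemma robustly_transitive_2:
  assumes h: "lifts 2 h model"
  shows "robustly_transitive 2 h"
proof -
  have "transitive g" if hg: "Cr_close 2 (1/2) h g" for g
  proof -
    obtain G where G: "lifts 2 g G" and close: "\<And>x vs. length vs \<le> 2 \<Longrightarrow> \<forall>v\<in>set vs. norm v = 1 \<Longrightarrow>
        norm (iter_deriv vs model x - iter_deriv vs G x) < 1/2"
      using lift_of_close_map[OF h hg] by auto
    have C2: "Ck_on 2 UNIV G" using G by (simp add: lifts_def)
    then have C1: "Ck_on 1 UNIV G" using Ck_on_Suc_imp[of 1 UNIV G] by (simp add: numeral_2_eq_2)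
    have c1: "norm (iter_deriv [v] model x - iter_deriv [v] G x) < 1/2" if "norm v = 1" for v x
      using close[of "[v]" x] that by simp
    have c2: "norm (iter_deriv [v, v] model x - iter_deriv [v, v] G x) < 1/2" if "norm v = 1" for v x
      using close[of "[v, v]" x] that by simp
    have "perturbation G"
    proof
      show "\<bar>(G q - model q) $ i - (G p - model p) $ i\<bar> \<le> norm (q - p) / 2" for q p i
        using first_order_closeness[OF Ck_on_model C1 c1, of q i p] by simp
      show "\<bar>(G (p + e) - model (p + e)) $ i + (G (p - e) - model (p - e)) $ i
          - 2 * (G p - model p) $ i\<bar> \<le> (norm e)\<^sup>2 / 2" for p e i
        using second_order_closeness[OF Ck_on_model C2 c2, of p e i] by simp
    qed
    with G show ?thesis by (rule transitive_of_perturbation)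
  qed
  then show ?thesis
    unfolding robustly_transitive_iff using lifts_imp_Cr_maps[OF h]
    by (intro conjI exI[of _ "1/2"]) auto
qed

section \<open>Flattening the fold in the coarser topology\<close>

text \<open>The function \<open>defect\<close> is nonnegative and vanishes exactly at the points where \<open>fib\<close> is maximal.\<close>

definition defect :: "real^2 \<Rightarrow> real" where
  "defect p = 160 - fib (p $ 1) (p $ 2)"

lemma defect_eq: "defect p = 20 * ((5 - 4 * sin (2*pi*p $ 2) + 3 * cos (2*pi*p $ 2))
    + 3 * (1 - cos (2*pi*p $ 1)) * (1 - cos (2*pi*p $ 2)))"
  by (simp add: defect_def fib_def algebra_simps)

lemma defect_zero: "\<exists>p. defect p = 0"
proof -
  have "(- 3/5)\<^sup>2 + (4/5)\<^sup>2 = (1::real)" by (simp add: power2_eq_square)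
  then obtain t where t: "- 3/5 = cos t" "4/5 = sin (t::real)"
    by (rule sincos_total_2pi)
  have "2 * pi * (t / (2 * pi)) = t" by simp
  then have "defect (pt 0 (t / (2*pi))) = 0"
    by (simp add: defect_eq flip: t)
  then show ?thesis ..
qed

definition defect_deriv :: "real^2 \<Rightarrow> real^2 \<Rightarrow> real" where
  "defect_deriv p v = 120 * pi * sin (2*pi*p $ 1) * (1 - cos (2*pi*p $ 2)) * v $ 1
    - 40 * pi * slope (p $ 1) (p $ 2) * v $ 2"

lemma defect_has_derivative: "(defect has_derivative defect_deriv p) (at p)"
proof -
  have nth: "((\<lambda>p::real^2. p $ i) has_derivative (\<lambda>v. v $ i)) (at p)" for i
    by (rule bounded_linear_imp_has_derivative) (rule bounded_linear_vec_nth)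
  show ?thesis
    unfolding defect_def fib_def
    by (rule has_derivative_eq_rhs, (rule derivative_intros nth)+)
      (simp add: fun_eq_iff defect_deriv_def slope_def algebra_simps)
qed

text \<open>A nonnegative function with bounded second derivatives has a gradient of at most the order of its
  square root. Here this is made explicit through \<open>defect = 20 (a + 3 b)\<close> with \<open>a, b \<ge> 0\<close>, where
  \<open>(4c + 3s)\<^sup>2 = 10 a - a\<^sup>2\<close>.\<close>

lemma defect_gradient_bound:
  assumes v: "norm v = 1"
  shows "\<bar>defect_deriv p v\<bar> \<le> 1000 * sqrt (defect p)" and "0 \<le> defect p"
proof -
  define S C c s where "S = sin (2*pi*p $ 1)" and "C = cos (2*pi*p $ 1)"
    and "c = cos (2*pi*p $ 2)" and "s = sin (2*pi*p $ 2)"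
  define a where "a = 5 - 4 * s + 3 * c"
  define b where "b = (1 - C) * (1 - c)"
  have sc: "s\<^sup>2 = 1 - c\<^sup>2" "S\<^sup>2 = 1 - C\<^sup>2"
    by (simp_all add: s_def c_def S_def C_def sin_squared_eq)
  have c: "- 1 \<le> c" "c \<le> 1" "- 1 \<le> C" "C \<le> 1"
    by (simp_all add: c_def C_def)
  have b: "0 \<le> b" using c by (simp add: b_def)
  have a2: "(4 * c + 3 * s)\<^sup>2 = 10 * a - a\<^sup>2"
    using sc(1) unfolding a_def power2_eq_square by algebra
  then have a: "0 \<le> a" using zero_le_power2[of "4 * c + 3 * s"] zero_le_power2[of a] by linarith
  have d: "defect p = 20 * (a + 3 * b)"
    by (simp add: defect_eq a_def b_def s_def c_def C_def)
  then show "0 \<le> defect p" using a b by simp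
  have "(S * (1 - c))\<^sup>2 = b * ((1 + C) * (1 - c))"
    using sc(2) unfolding b_def power2_eq_square by algebra
  also have "\<dots> \<le> b * (2 * 2)"
    using c b by (intro mult_left_mono mult_mono) auto
  finally have x: "(S * (1 - c))\<^sup>2 \<le> 4 * b" by simp
  have "((1 - C) * s)\<^sup>2 = b * ((1 - C) * (1 + c))"
    using sc(1) unfolding b_def power2_eq_square by algebra
  also have "\<dots> \<le> b * (2 * 2)"
    using c b by (intro mult_left_mono mult_mono) auto
  finally have y: "((1 - C) * s)\<^sup>2 \<le> 4 * b" by simp
  have "slope (p $ 1) (p $ 2) = (4 * c + 3 * s) - 3 * ((1 - C) * s)"
    by (simp add: slope_def c_def s_def C_def algebra_simps)
  then have "(slope (p $ 1) (p $ 2))\<^sup>2 + ((4 * c + 3 * s) + 3 * ((1 - C) * s))\<^sup>2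
      = 2 * (4 * c + 3 * s)\<^sup>2 + 18 * ((1 - C) * s)\<^sup>2"
    by (simp add: power2_eq_square algebra_simps)
  then have z: "(slope (p $ 1) (p $ 2))\<^sup>2 \<le> 20 * a + 72 * b"
    using a2 y zero_le_power2[of "(4 * c + 3 * s) + 3 * ((1 - C) * s)"] zero_le_power2[of a] by linarith
  have v2: "\<bar>v $ i\<bar> \<le> 1" for i using component_le_norm_cart[of v i] v by simp
  define A B where "A = 120 * pi * (S * (1 - c))" and "B = 40 * pi * slope (p $ 1) (p $ 2)"
  have "defect_deriv p v = A * v $ 1 - B * v $ 2"
    by (simp add: defect_deriv_def A_def B_def S_def c_def)
  then have "\<bar>defect_deriv p v\<bar> \<le> \<bar>A * v $ 1\<bar> + \<bar>B * v $ 2\<bar>" by simp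
  also have "\<dots> \<le> \<bar>A\<bar> + \<bar>B\<bar>"
    unfolding abs_mult using v2[of 1] v2[of 2] by (intro add_mono mult_left_le) auto
  also have "\<dots> \<le> sqrt (1000000 * defect p)"
  proof (rule real_le_rsqrt)
    have pi2: "pi\<^sup>2 \<le> 16" using power_mono[of pi 4 2] pi_less_4 by simp
    have "A\<^sup>2 = 14400 * pi\<^sup>2 * (S * (1 - c))\<^sup>2" by (simp add: A_def power_mult_distrib)
    also have "\<dots> \<le> 14400 * 16 * (4 * b)"
      using pi2 x by (intro mult_mono) auto
    finally have A: "A\<^sup>2 \<le> 921600 * b" by simp
    have "B\<^sup>2 = 1600 * pi\<^sup>2 * (slope (p $ 1) (p $ 2))\<^sup>2" by (simp add: B_def power_mult_distrib)
    also have "\<dots> \<le> 1600 * 16 * (20 * a + 72 * b)"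
      using pi2 z by (intro mult_mono) auto
    finally have B: "B\<^sup>2 \<le> 512000 * a + 1843200 * b" by simp
    have "(\<bar>A\<bar> + \<bar>B\<bar>)\<^sup>2 + (\<bar>A\<bar> - \<bar>B\<bar>)\<^sup>2 = 2 * A\<^sup>2 + 2 * B\<^sup>2"
      by (simp add: power2_sum power2_diff)
    then have "(\<bar>A\<bar> + \<bar>B\<bar>)\<^sup>2 \<le> 2 * A\<^sup>2 + 2 * B\<^sup>2"
      using zero_le_power2[of "\<bar>A\<bar> - \<bar>B\<bar>"] by argo
    also have "\<dots> \<le> 1000000 * defect p"
      using A B a b unfolding d by simp
    finally show "(\<bar>A\<bar> + \<bar>B\<bar>)\<^sup>2 \<le> 1000000 * defect p" .
  qed
  also have "\<dots> = 1000 * sqrt (defect p)"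
    using real_sqrt_unique[of 1000 1000000] by (simp add: real_sqrt_mult)
  finally show "\<bar>defect_deriv p v\<bar> \<le> 1000 * sqrt (defect p)" .
qed

lemma defect_le: "defect p \<le> 360"
proof -
  have "\<bar>cos (2*pi*p $ 1) * (1 - cos (2*pi*p $ 2))\<bar> \<le> 1 * 2"
    unfolding abs_mult by (intro mult_mono) (auto simp: abs_le_iff intro: order_trans[OF _ cos_ge_minus_one])
  moreover have "- 1 \<le> sin (2*pi*p $ 2)" by simp
  ultimately show ?thesis
    unfolding defect_def fib_def abs_le_iff mult.assoc[of 3] by argo
qed

text \<open>A \<open>C\<^sup>1\<close> substitute for the identity on \<open>[0, \<infinity>)\<close> that vanishes near \<open>0\<close>. Its derivative differs
  from \<open>1\<close> substantially only for \<open>t\<close> of the order of \<open>d\<close>, where the gradient of \<open>defect\<close> is of the order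
  of \<open>sqrt d\<close>.\<close>

definition flat :: "real \<Rightarrow> real \<Rightarrow> real" where
  "flat d t = (if t \<le> d then 0 else (t - d)\<^sup>2 / t)"

definition flat' :: "real \<Rightarrow> real \<Rightarrow> real" where
  "flat' d t = (if t \<le> d then 0 else 1 - d\<^sup>2 / t\<^sup>2)"

lemma flat_has_derivative:
  assumes d: "0 < d"
  shows "(flat d has_real_derivative flat' d t) (at t)"
proof -
  have right: "((\<lambda>t. (t - d)\<^sup>2 / t) has_real_derivative 1 - d\<^sup>2 / t\<^sup>2) (at t)" if "t \<noteq> 0" for t
    using that by (auto intro!: derivative_eq_intros simp: field_simps power2_eq_square)
  consider "t < d" | "t = d" | "d < t" by linarith
  then show ?thesis
  proof cases
    case 1
    have "((\<lambda>t. 0) has_real_derivative flat' d t) (at t)"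
      using 1 by (simp add: flat'_def)
    then show ?thesis
      by (rule DERIV_cong_ev[THEN iffD1, rotated -1]) 
        (use 1 in \<open>auto simp: flat_def eventually_nhds intro!: exI[of _ "{..<d}"]\<close>)
  next
    case 3
    have "((\<lambda>t. (t - d)\<^sup>2 / t) has_real_derivative flat' d t) (at t)"
      using 3 d right[of t] by (simp add: flat'_def)
    then show ?thesis
      by (rule DERIV_cong_ev[THEN iffD1, rotated -1])
        (use 3 in \<open>auto simp: flat_def eventually_nhds intro!: exI[of _ "{d<..}"]\<close>)
  next
    case 2
    have at_d: "((\<lambda>t. (t - d)\<^sup>2 / t) has_vector_derivative 0) (at d within S)" for S
      using right[of d] d
      by (simp add: has_field_derivative_at_within flip: has_real_derivative_iff_has_vector_derivative)
    have "((\<lambda>t. if t \<in> {d..} then (t - d)\<^sup>2 / t else 0) has_vector_derivative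
        (if t \<in> {d..} then 1 - d\<^sup>2 / t\<^sup>2 else 0)) (at t within UNIV)"
      by (rule has_vector_derivative_If_within_closures[where T = "{..<d}"])
        (use 2 d at_d in auto)
    moreover have "(\<lambda>t. if t \<in> {d..} then (t - d)\<^sup>2 / t else 0) = flat d"
      by (auto simp: flat_def fun_eq_iff)
    ultimately show ?thesis
      using 2 d by (simp add: flat'_def has_real_derivative_iff_has_vector_derivative)
  qed
qed

lemma continuous_flat':
  assumes d: "0 < d"
  shows "continuous_on UNIV (flat' d)"
proof -
  have "flat' d t = 1 - d\<^sup>2 / (max t d)\<^sup>2" for t
    using d by (auto simp: flat'_def max_def)
  then have "flat' d = (\<lambda>t. 1 - d\<^sup>2 / (max t d)\<^sup>2)" by auto
  moreover have "max t d \<noteq> 0" for t using d by (auto simp: max_def)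
  ultimately show ?thesis by (auto intro!: continuous_intros)
qed

lemma flat_bounds:
  assumes d: "0 < d" and t: "0 \<le> t"
  shows "0 \<le> flat d t" "flat d t \<le> t" "t - flat d t \<le> 2 * d"
    "0 \<le> flat' d t" "flat' d t \<le> 1" "(1 - flat' d t) * sqrt t \<le> sqrt d"
proof -
  have q: "flat d t = t - 2 * d + d\<^sup>2 / t" if "d < t"
    using that d by (simp add: flat_def field_simps power2_eq_square)
  show "0 \<le> flat d t" using t by (simp add: flat_def)
  have "d\<^sup>2 / t \<le> d" if "d < t"
    using that d by (simp add: field_simps power2_eq_square)
  then show "flat d t \<le> t" using q t d by (cases "d < t") (auto simp: flat_def)
  show "t - flat d t \<le> 2 * d" using q t d by (cases "d < t") (auto simp: flat_def)
  have le1: "d\<^sup>2 / t\<^sup>2 \<le> 1" if "d < t"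
    using that d power_mono[of d t 2] by (simp add: field_simps)
  then show "0 \<le> flat' d t" by (simp add: flat'_def)
  show "flat' d t \<le> 1" by (simp add: flat'_def)
  show "(1 - flat' d t) * sqrt t \<le> sqrt d"
  proof (cases "d < t")
    case True
    then have dt: "0 < d / t" "d / t \<le> 1" using d by auto
    have "(1 - flat' d t) * sqrt t = (d / t)\<^sup>2 * sqrt t"
      using True by (simp add: flat'_def power_divide)
    also have "\<dots> \<le> sqrt (d / t) * sqrt t"
    proof (intro mult_right_mono real_le_rsqrt)
      have "((d / t)\<^sup>2)\<^sup>2 = (d / t) ^ 4" by simp
      also have "\<dots> \<le> (d / t) ^ 1" using dt by (intro power_decreasing) auto
      finally show "((d / t)\<^sup>2)\<^sup>2 \<le> d / t" by simp
    qed (use t in simp)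
    also have "\<dots> = sqrt d" using True d by (simp flip: real_sqrt_mult)
    finally show ?thesis .
  next
    case False
    then show ?thesis by (simp add: flat'_def)
  qed
qed

text \<open>The factor that restores the value at \<open>160\<close>, the value of \<open>defect\<close> on the circle \<open>y = 0\<close>; this keeps
  that circle invariant.\<close>

definition flat_scale :: "real \<Rightarrow> real" where
  "flat_scale d = 25600 / (160 - d)\<^sup>2"

lemma flat_scale:
  assumes "0 < d" "d \<le> 1"
  shows "1 \<le> flat_scale d" "flat_scale d \<le> 1 + d" "flat_scale d * flat d 160 = 160"
proof -
  have p: "0 < (160 - d)\<^sup>2" using assms by simp
  have "(160 - d)\<^sup>2 \<le> 160\<^sup>2" using assms by (intro power_mono) auto
  then show "1 \<le> flat_scale d" using p by (simp add: flat_scale_def)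
  have "(1 + d) * (160 - d)\<^sup>2 = 25600 + d * (25280 - 319 * d + d * d)"
    by (simp add: power2_eq_square algebra_simps)
  moreover have "0 \<le> d * (25280 - 319 * d + d * d)"
    using assms by (intro mult_nonneg_nonneg) (auto simp: add_nonneg_nonneg)
  ultimately have "25600 \<le> (1 + d) * (160 - d)\<^sup>2" by simp
  then show "flat_scale d \<le> 1 + d" using p by (simp add: flat_scale_def divide_le_eq)
  show "flat_scale d * flat d 160 = 160"
    using assms by (simp add: flat_scale_def flat_def)
qed

definition corr :: "real \<Rightarrow> real \<Rightarrow> real" where
  "corr d t = t - flat_scale d * flat d t"

lemma corr_bounds:
  assumes d: "0 < d" "d \<le> 1" and t: "0 \<le> t" "t \<le> 360"
  shows "\<bar>corr d t\<bar> \<le> 360 * d" "\<bar>1 - flat_scale d * flat' d t\<bar> * sqrt t \<le> 21 * sqrt d"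
proof -
  note s = flat_scale[OF d] and f = flat_bounds[OF d(1) t(1)]
  have "(flat_scale d - 1) * flat d t \<le> d * 360"
    using s f t d by (intro mult_mono) auto
  moreover have "0 \<le> (flat_scale d - 1) * flat d t" using s f by simp
  moreover have "corr d t = (t - flat d t) - (flat_scale d - 1) * flat d t"
    by (simp add: corr_def algebra_simps)
  ultimately show "\<bar>corr d t\<bar> \<le> 360 * d" using f d unfolding abs_le_iff by linarith
  have "sqrt t \<le> sqrt (20\<^sup>2)" using t by (intro real_sqrt_le_mono) simp
  then have t20: "sqrt t \<le> 20" by simp
  have "d = sqrt d * sqrt d" using d by simp
  also have "\<dots> \<le> sqrt d * 1" using d by (intro mult_left_mono) auto
  finally have dd: "d \<le> sqrt d" by simp
  have "(flat_scale d - 1) * flat' d t * sqrt t \<le> d * 1 * 20"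
    using s f t d t20 by (intro mult_mono) auto
  moreover have "\<bar>1 - flat_scale d * flat' d t\<bar> \<le> (1 - flat' d t) + (flat_scale d - 1) * flat' d t"
  proof -
    have "1 - flat_scale d * flat' d t = (1 - flat' d t) - (flat_scale d - 1) * flat' d t"
      by (simp add: algebra_simps)
    moreover have "0 \<le> (flat_scale d - 1) * flat' d t" using s f by simp
    ultimately show ?thesis using f by (simp add: abs_le_iff)
  qed
  then have "\<bar>1 - flat_scale d * flat' d t\<bar> * sqrt t
      \<le> ((1 - flat' d t) + (flat_scale d - 1) * flat' d t) * sqrt t"
    using t by (intro mult_right_mono) auto
  ultimately show "\<bar>1 - flat_scale d * flat' d t\<bar> * sqrt t \<le> 21 * sqrt d"
    using f(6) dd by (simp add: distrib_right)
qed

text \<open>Replacing \<open>defect\<close> by \<open>flat_scale d * flat d defect\<close> in \<open>fib = 160 - defect\<close>.\<close>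

definition flattened :: "real \<Rightarrow> real^2 \<Rightarrow> real^2" where
  "flattened d p = model p + pt 0 (corr d (defect p))"

lemma flattened_has_derivative:
  assumes d: "0 < d"
  shows "(flattened d has_derivative (\<lambda>v. frechet_derivative model (at p) v
    + pt 0 ((1 - flat_scale d * flat' d (defect p)) * defect_deriv p v))) (at p)"
proof -
  have m: "(model has_derivative frechet_derivative model (at p)) (at p)"
    using Ck_on_model[of 1] Ck_on_Suc_has_derivative[of 0 model p] by simp
  have "(corr d has_real_derivative (1 - flat_scale d * flat' d t)) (at t)" for t
    unfolding corr_def[abs_def] by (auto intro!: derivative_eq_intros flat_has_derivative[OF d])
  from DERIV_compose_FDERIV[OF this defect_has_derivative]
  have "((\<lambda>p. corr d (defect p)) has_derivative
      (\<lambda>v. defect_deriv p v * (1 - flat_scale d * flat' d (defect p)))) (at p)" .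
  from has_derivative_add[OF m bounded_linear.has_derivative[OF bounded_linear_pt(2) this]]
  show ?thesis
    unfolding flattened_def[abs_def] by (simp add: mult.commute)
qed

lemma Ck_on_flattened:
  assumes d: "0 < d"
  shows "Ck_on 1 UNIV (flattened d)"
proof -
  have "Ck_on (Suc 0) UNIV (flattened d)"
  proof (rule Ck_on_SucI[OF flattened_has_derivative[OF d]])
    fix v
    have "continuous_on UNIV (\<lambda>p. frechet_derivative model (at p) v)"
      using Ck_on_model[of 1] by simp
    moreover have "continuous_on UNIV defect"
      by (rule has_derivative_continuous_on[OF has_derivative_at_withinI[OF defect_has_derivative]])
    then have "continuous_on UNIV (\<lambda>p. flat' d (defect p))"
      by (rule continuous_on_compose2[OF continuous_flat'[OF d]]) auto
    moreover have "continuous_on UNIV (\<lambda>p. defect_deriv p v)"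
      unfolding defect_deriv_def slope_def by (intro continuous_intros)
    ultimately show "Ck_on 0 UNIV (\<lambda>p. frechet_derivative model (at p) v
      + pt 0 ((1 - flat_scale d * flat' d (defect p)) * defect_deriv p v))"
      unfolding pt_def Ck_on.simps by (intro continuous_intros)
  qed
  then show ?thesis by simp
qed

lemma defect_periodic: "(\<And>i. p $ i - q $ i \<in> \<int>) \<Longrightarrow> defect p = defect q"
  unfolding defect_def using fib_periodic[of "p $ 1" "q $ 1" "p $ 2" "q $ 2"] by simp

lemma flattened_close:
  assumes h: "lifts 1 h model" and g: "lifts 1 g (flattened d)"
    and d: "0 < d" "d \<le> 1" "30000 * sqrt d < e"
  shows "Cr_close 1 e h g"
  unfolding Cr_close_def
proof
  fix x
  have s0: "0 \<le> defect x"
    using defect_gradient_bound(2)[of "axis 1 1" x] by (simp add: norm_axis_1)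
  note b = corr_bounds[OF d(1,2) s0 defect_le]
  have "norm (iter_deriv vs model x - iter_deriv vs (flattened d) x) < e"
    if len: "length vs \<le> 1" and unit: "\<forall>v\<in>set vs. norm v = 1" for vs
  proof (cases vs)
    case Nil
    have "d = sqrt d * sqrt d" using d by simp
    also have "\<dots> \<le> sqrt d * 1" using d by (intro mult_left_mono) auto
    finally have "\<bar>corr d (defect x)\<bar> < e" using b(1) d(1,3) by simp
    then show ?thesis
      using Nil norm_vec2_le[of "- pt 0 (corr d (defect x))"] by (simp add: flattened_def)
  next
    case (Cons v ws)
    then have v: "vs = [v]" "norm v = 1" using len unit by auto
    let ?m = "1 - flat_scale d * flat' d (defect x)"
    have "iter_deriv vs (flattened d) x = iter_deriv vs model x + pt 0 (?m * defect_deriv x v)"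
      using frechet_derivative_at[OF flattened_has_derivative[OF d(1), of x], symmetric] v(1) by simp
    then have "norm (iter_deriv vs model x - iter_deriv vs (flattened d) x) \<le> \<bar>?m\<bar> * \<bar>defect_deriv x v\<bar>"
      using norm_vec2_le[of "- pt 0 (?m * defect_deriv x v)"] by (simp add: abs_mult)
    also have "\<dots> \<le> \<bar>?m\<bar> * (1000 * sqrt (defect x))"
      by (intro mult_left_mono defect_gradient_bound v) simp
    also have "\<dots> = 1000 * (\<bar>?m\<bar> * sqrt (defect x))" by simp
    also have "\<dots> \<le> 1000 * (21 * sqrt d)" using b(2) by (intro mult_left_mono) auto
    also have "\<dots> < e" using d(1,3) real_sqrt_ge_zero[of d] by linarith
    finally show ?thesis .
  qed
  then show "\<exists>F G. local_lift 1 h x F \<and> local_lift 1 g x G \<and>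
      (\<forall>vs. length vs \<le> 1 \<longrightarrow> (\<forall>v\<in>set vs. norm v = 1) \<longrightarrow>
        norm (iter_deriv vs F x - iter_deriv vs G x) < e)"
    using lifts_imp_local_lift[OF h] lifts_imp_local_lift[OF g] by blast
qed

text \<open>Both the circle \<open>y = 0\<close> and the open set where \<open>defect < d\<close> are mapped into that circle, since
  \<open>160\<close> is an integer.\<close>

lemma flattened_not_transitive:
  assumes g: "lifts 1 g (flattened d)" and d: "0 < d" "d \<le> 1"
  shows "\<not> transitive g"
proof
  assume tr: "transitive g"
  define A where "A = torus_proj ` {p. p $ 2 \<in> \<int>}"
  define U where "U = torus_proj ` {p. defect p < d}"
  have second: "flattened d p $ 2 \<in> \<int>" if "p $ 2 \<in> \<int> \<or> defect p < d" for p
  proof (cases "defect p < d")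
    case True
    then show ?thesis by (simp add: flattened_def model_def corr_def flat_def defect_def)
  next
    case False
    then have "p $ 2 \<in> \<int>" using that by blast
    then have "fib (p $ 1) (p $ 2) = 0"
      by (simp add: fib_def sin_integer_2pi cos_integer_2pi)
    then show ?thesis
      using flat_scale(3)[OF d] by (simp add: flattened_def model_def corr_def defect_def)
  qed
  have step: "g t \<in> A" if "t \<in> A \<union> U" for t
  proof -
    obtain p where p: "t = torus_proj p" "p $ 2 \<in> \<int> \<or> defect p < d"
      using \<open>t \<in> A \<union> U\<close> unfolding A_def U_def by blast
    have "g t = torus_proj (flattened d p)" using g p(1) by (simp add: lifts_def)
    then show ?thesis using second[OF p(2)] by (simp add: A_def)
  qed
  have iter: "(g ^^ n) t \<in> A" if "1 \<le> n" "t \<in> U" for n t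
    using that(1)
  proof (induction n rule: dec_induct)
    case base
    show ?case using step that(2) by simp
  next
    case (step n)
    then show ?case using \<open>\<And>t. t \<in> A \<union> U \<Longrightarrow> g t \<in> A\<close> by simp
  qed
  have A: "torus_proj p \<in> A \<longleftrightarrow> p $ 2 \<in> \<int>" for p
  proof
    assume "torus_proj p \<in> A"
    then obtain q where q: "q $ 2 \<in> \<int>" "torus_proj p = torus_proj q"
      unfolding A_def by blast
    then have "p $ 2 - q $ 2 \<in> \<int>" by (simp add: torus_proj_eq_iff)
    from Ints_add[OF q(1) this] show "p $ 2 \<in> \<int>" by simp
  qed (simp add: A_def)
  have U: "torus_proj p \<in> U \<longleftrightarrow> defect p < d" for p
    unfolding U_def using defect_periodic by (force simp: torus_proj_eq_iff)
  have "continuous_on UNIV defect"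
    by (rule has_derivative_continuous_on[OF has_derivative_at_withinI[OF defect_has_derivative]])
  then have "open {p. defect p < d}" by (intro open_Collect_less) auto
  moreover have "torus_proj -` U = {p. defect p < d}" using U by auto
  ultimately have "open U" by (simp add: open_torus_def)
  moreover have "U \<noteq> {}"
  proof -
    obtain z where "defect z = 0" using defect_zero by blast
    then have "torus_proj z \<in> U" using U d(1) by simp
    then show ?thesis by blast
  qed
  moreover have "open (- A)"
  proof -
    have "closed ((\<lambda>p::real^2. p $ 2) -` \<int>)"
      by (intro closed_vimage closed_Ints continuous_intros)
    moreover have "torus_proj -` (- A) = - ((\<lambda>p::real^2. p $ 2) -` \<int>)" using A by auto
    ultimately show ?thesis unfolding open_torus_def by (metis open_Compl)
  qed
  moreover have "- A \<noteq> {}"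
  proof -
    have "torus_proj (pt 0 (1/2)) \<notin> A"
      unfolding A pt_nth by (simp add: fraction_not_in_Ints)
    then show ?thesis by blast
  qed
  ultimately obtain n where "1 \<le> n" "(g ^^ n) ` U \<inter> (- A) \<noteq> {}"
    using tr unfolding transitive_def by blast
  then show False using iter by blast
qed

lemma not_robustly_transitive_1:
  assumes h: "lifts 1 h model"
  shows "\<not> robustly_transitive 1 h"
proof
  assume "robustly_transitive 1 h"
  then obtain e where e: "e > 0" "\<And>g. g \<in> Cr_maps 1 \<Longrightarrow> Cr_close 1 e h g \<Longrightarrow> transitive g"
    unfolding robustly_transitive_iff by blast
  define m where "m = min 1 (e / 40000)"
  have m: "0 < m" "m \<le> 1" "30000 * m < e" using e(1) by (auto simp: m_def min_def)
  define d where "d = m\<^sup>2"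
  have d: "0 < d" "d \<le> 1" "30000 * sqrt d < e"
    using m by (auto simp: d_def power_le_one)
  have "flattened d p $ i - flattened d q $ i \<in> \<int>" if "\<And>i. p $ i - q $ i \<in> \<int>" for p q i
    using model_int[OF that, of i] defect_periodic[OF that] by (simp add: flattened_def)
  then obtain g where g: "lifts 1 g (flattened d)"
    using lifts_ex[OF Ck_on_flattened[OF d(1)]] by blast
  show False
    using e(2)[OF lifts_imp_Cr_maps[OF g] flattened_close[OF h g d]] flattened_not_transitive[OF g d(1,2)]
    by blast
qed

theorem mainTheorem1:
  "\<exists>h :: torus \<Rightarrow> torus. h \<in> Cr_maps 2 \<and> robustly_transitive 2 h \<and> \<not> robustly_transitive 1 h"
proof -
  obtain h where h: "lifts 2 h model"
    using lifts_ex[OF Ck_on_model model_int] by blast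
  then have "lifts 1 h model"
    using Ck_on_model by (simp add: lifts_def)
  then show ?thesis
    using lifts_imp_Cr_maps[OF h] robustly_transitive_2[OF h] not_robustly_transitive_1 by blast
qed

end
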